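(* Let $A$ be an irreducible affine Cartan matrix which is not of type $B_n^{(1)}, C_n^{(1)}, F_4^{(1)}, G_2^{(1)}$, and let $\mathcal A$ be the associated triple group. Consider the following assignments on the generators of $\mathcal A$, both fixing every generator $\mathcal T_i$ with $i\neq 0$: $$\underline{\mathfrak a}:\ \mathcal T_{03}\mapsto \mathcal T_{03},\quad \mathcal T_{01}\mapsto \mathcal T_{02},\quad \mathcal T_{02}\mapsto \mathcal T_{02}^{-1}\mathcal T_{01}\mathcal T_{02},$$ $$\underline{\mathfrak b}:\ \mathcal T_{01}\mapsto \mathcal T_{01},\quad \mathcal T_{02}\mapsto \mathcal T_{03},\quad \mathcal T_{03}\mapsto \mathcal T_{03}^{-1}\mathcal T_{02}\mathcal T_{03}.$$ Then $\underline{\mathfrak a}$ and $\underline{\mathfrak b}$ define automorphisms of the group $\mathcal A$. Moreover, with $B_3=\langle \mathfrak a,\mathfrak b\mid \mathfrak a\mathfrak b\mathfrak a=\mathfrak b\mathfrak a\mathfrak b\rangle$ the braid group on three letters, the map $\mathfrak a\mapsto\underline{\mathfrak a}$, $\mathfrak b\mapsto\underline{\mathfrak b}$ defines a group morphism $\Upsilon: B_3\to \mathrm{Aut}(\mathcal A)$.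
   Context: $A=(a_{jk})_{0\le j,k\le n}$ is an irreducible affine Cartan matrix, labelled as in Kac's book, node $0$ being the affine node; types $B_n^{(1)}, C_n^{(1)}, F_4^{(1)}, G_2^{(1)}$ are excluded. In the Dynkin diagram $S(A)$ distinct nodes $i,j$ are connected by $a_{ij}a_{ji}$ laces. The braid relation between elements $x,y$ attached to distinct nodes $i,j$ is $xyx\cdots=yxy\cdots$ with $m_{ij}$ factors on each side, $m_{ij}=2,3,4,6$ if the nodes are connected by $0,1,2,3$ laces (no relation for $4$ laces, which happens only when $n=1$). The single lace Coxeter relation between $x$ and $y$ is $xyx=yxy$. The triple group $\mathcal A$ is the group with generators $\mathcal T_i$, one for each node $i\ne 0$, and three generators $\mathcal T_{01},\mathcal T_{02},\mathcal T_{03}$ attached to the affine node $0$; put $\mathcal D=\mathcal T_{01}\mathcal T_{02}\mathcal T_{03}$. The relations are: a) the braid relation for each pair of generators attached to two distinct nodes (so there is no relation of this kind among the $\mathcal T_{0i}$); b) if the affine node is connected with a node $\alpha$ by a single lace, then each of $\mathcal T_{01}$, $\mathcal T_{02}$, $\mathcal T_{03}$, $\mathcal T_{01}\mathcal T_{02}\mathcal T_{01}^{-1}$, $\mathcal T_{03}^{-1}\mathcal T_{02}\mathcal T_{03}$ satisfies the single lace Coxeter relation with $\mathcal D^k\mathcal T_\alpha\mathcal D^{-k}$ for all $k\in\mathbb Z$ (this is imposed for every such node $\alpha$); c) if the affine node is connected with a node $\alpha$ by two laces, then $\mathcal T_{0i}\mathcal T_\alpha^{-1}\mathcal T_{0j}\mathcal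 T_\alpha=\mathcal T_\alpha^{-1}\mathcal T_{0j}\mathcal T_\alpha\mathcal T_{0i}$ for all $1\le i<j\le 3$. *)

theory Defs
  imports Complex_Main "HOL-Algebra.Bij"
begin

section \<open>Groups given by generators and relations\<close>

text \<open>A word is a list of letters; the letter \<open>(g, True)\<close> stands for the generator \<open>g\<close> and
  \<open>(g, False)\<close> for its inverse. Defining relations are pairs of words.\<close>

type_synonym 'g word = "('g \<times> bool) list"

definition wgen :: "'g \<Rightarrow> 'g word" where
  "wgen g = [(g, True)]"

definition winv :: "'g word \<Rightarrow> 'g word" where
  "winv w = rev (map (\<lambda>(g, e). (g, \<not> e)) w)"

definition wpow :: "'g word \<Rightarrow> int \<Rightarrow> 'g word" where
  "wpow w k = (if 0 \<le> k then concat (replicate (nat k) w)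
               else concat (replicate (nat (- k)) (winv w)))"

definition words :: "'g set \<Rightarrow> 'g word set" where
  "words S = lists (S \<times> UNIV)"

inductive_set word_cong :: "'g set \<Rightarrow> ('g word \<times> 'g word) set \<Rightarrow> ('g word \<times> 'g word) set"
  for S :: "'g set" and R :: "('g word \<times> 'g word) set" where
  refl: "w \<in> words S \<Longrightarrow> (w, w) \<in> word_cong S R"
| sym: "(v, w) \<in> word_cong S R \<Longrightarrow> (w, v) \<in> word_cong S R"
| trans: "(u, v) \<in> word_cong S R \<Longrightarrow> (v, w) \<in> word_cong S R \<Longrightarrow> (u, w) \<in> word_cong S R"
| cancel: "u \<in> words S \<Longrightarrow> v \<in> words S \<Longrightarrow> g \<in> S
    \<Longrightarrow> (u @ [(g, e), (g, \<not> e)] @ v, u @ v) \<in> word_cong S R"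
| rel: "u \<in> words S \<Longrightarrow> v \<in> words S \<Longrightarrow> (l, r) \<in> R \<Longrightarrow> l \<in> words S \<Longrightarrow> r \<in> words S
    \<Longrightarrow> (u @ l @ v, u @ r @ v) \<in> word_cong S R"

definition word_class :: "'g set \<Rightarrow> ('g word \<times> 'g word) set \<Rightarrow> 'g word \<Rightarrow> 'g word set" where
  "word_class S R w = word_cong S R `` {w}"

definition presented_group :: "'g set \<Rightarrow> ('g word \<times> 'g word) set \<Rightarrow> 'g word set monoid" where
  "presented_group S R =
    \<lparr>carrier = words S // word_cong S R,
     mult = (\<lambda>X Y. \<Union>x\<in>X. \<Union>y\<in>Y. word_class S R (x @ y)),
     one = word_class S R []\<rparr>"

lemma words_append [simp]: "u @ v \<in> words S \<longleftrightarrow> u \<in> words S \<and> v \<in> words S"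
  by (auto simp: words_def)

lemma words_Nil [simp]: "[] \<in> words S"
  by (simp add: words_def)

lemma winv_words: "w \<in> words S \<Longrightarrow> winv w \<in> words S"
  by (auto simp: words_def winv_def in_lists_conv_set)

lemma word_cong_words: "(v, w) \<in> word_cong S R \<Longrightarrow> v \<in> words S \<and> w \<in> words S"
  by (induction rule: word_cong.induct) (auto simp: words_def)

lemma equiv_word_cong: "equiv (words S) (word_cong S R)"
proof (rule equivI)
  show "word_cong S R \<subseteq> words S \<times> words S"
    by (auto dest: word_cong_words)
  show "refl_on (words S) (word_cong S R)"
    by (auto simp: refl_on_def intro: word_cong.refl dest: word_cong_words)
  show "sym_on UNIV (word_cong S R)"
    unfolding sym_def by (intro allI impI) (rule word_cong.sym)
  show "trans_on UNIV (word_cong S R)"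
    unfolding trans_def by (intro allI impI) (rule word_cong.trans)
qed

lemma word_cong_context:
  assumes "(v, w) \<in> word_cong S R" "a \<in> words S" "b \<in> words S"
  shows "(a @ v @ b, a @ w @ b) \<in> word_cong S R"
  using assms(1)
proof (induction rule: word_cong.induct)
  case (refl w)
  then show ?case using assms(2,3) by (intro word_cong.refl) simp
next
  case (sym v w)
  show ?case by (rule word_cong.sym[OF sym.IH])
next
  case (trans u v w)
  show ?case by (rule word_cong.trans[OF trans.IH])
next
  case (cancel u v g e)
  then show ?case
    using word_cong.cancel[of "a @ u" S "v @ b" g e R] assms(2,3) by simp
next
  case (rel u v l r)
  then show ?case
    using word_cong.rel[of "a @ u" S "v @ b" l r R] assms(2,3) by simp
qed

lemma word_cong_append:
  assumes "(v, v') \<in> word_cong S R" "(w, w') \<in> word_cong S R"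
  shows "(v @ w, v' @ w') \<in> word_cong S R"
proof (rule word_cong.trans)
  show "(v @ w, v' @ w) \<in> word_cong S R"
    using word_cong_context[OF assms(1), of "[]" w] assms[THEN word_cong_words] by simp
  show "(v' @ w, v' @ w') \<in> word_cong S R"
    using word_cong_context[OF assms(2), of v' "[]"] assms[THEN word_cong_words] by simp
qed

lemma word_class_eq_iff:
  "v \<in> words S \<Longrightarrow> w \<in> words S \<Longrightarrow>
    word_class S R v = word_class S R w \<longleftrightarrow> (v, w) \<in> word_cong S R"
  unfolding word_class_def by (rule eq_equiv_class_iff[OF equiv_word_cong])

lemma carrier_presented_group:
  "carrier (presented_group S R) = word_class S R ` words S"
  by (auto simp: presented_group_def quotient_def word_class_def)

lemma one_presented_group: "\<one>\<^bsub>presented_group S R\<^esub> = word_class S R []"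
  by (simp add: presented_group_def)

lemma mult_presented_group:
  assumes "v \<in> words S" "w \<in> words S"
  shows "word_class S R v \<otimes>\<^bsub>presented_group S R\<^esub> word_class S R w = word_class S R (v @ w)"
proof -
  have "word_class S R (x @ y) = word_class S R (v @ w)"
    if "x \<in> word_class S R v" "y \<in> word_class S R w" for x y
  proof -
    from that have "(v, x) \<in> word_cong S R" "(w, y) \<in> word_cong S R"
      by (auto simp: word_class_def)
    then have c: "(v @ w, x @ y) \<in> word_cong S R" by (rule word_cong_append)
    show ?thesis
      unfolding word_class_def using equiv_class_eq[OF equiv_word_cong c] by simp
  qed
  moreover have "v \<in> word_class S R v" "w \<in> word_class S R w"
    using assms by (auto simp: word_class_def intro: word_cong.refl)
  ultimately have "(\<Union>x\<in>word_class S R v. \<Union>y\<in>word_class S R w. word_class S R (x @ y))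
      = word_class S R (v @ w)"
    by blast
  then show ?thesis
    by (simp add: presented_group_def)
qed

lemma word_cong_winv:
  assumes "w \<in> words S"
  shows "(winv w @ w, []) \<in> word_cong S R"
  using assms
proof (induction w)
  case Nil
  then show ?case by (simp add: winv_def word_cong.refl)
next
  case (Cons x w)
  obtain g e where x: "x = (g, e)" by (cases x)
  from Cons.prems x have w: "w \<in> words S" and g: "g \<in> S" by (auto simp: words_def)
  have "(winv w @ [(g, \<not> e), (g, \<not> \<not> e)] @ w, winv w @ w) \<in> word_cong S R"
    by (rule word_cong.cancel) (auto simp: w g winv_words)
  from word_cong.trans[OF this Cons.IH[OF w]] show ?case
    by (simp add: winv_def x)
qed

theorem group_presented_group: "group (presented_group S R)" (is "group ?G")
proof (rule groupI)
  fix x y z assume "x \<in> carrier ?G" "y \<in> carrier ?G" "z \<in> carrier ?G"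
  then obtain u v w where uvw: "u \<in> words S" "v \<in> words S" "w \<in> words S"
    and xyz: "x = word_class S R u" "y = word_class S R v" "z = word_class S R w"
    unfolding carrier_presented_group by blast
  have xy: "x \<otimes>\<^bsub>?G\<^esub> y = word_class S R (u @ v)"
    unfolding xyz using uvw by (intro mult_presented_group)
  then show "x \<otimes>\<^bsub>?G\<^esub> y \<in> carrier ?G"
    unfolding xy carrier_presented_group using uvw by (intro imageI) simp
  show "x \<otimes>\<^bsub>?G\<^esub> y \<otimes>\<^bsub>?G\<^esub> z = x \<otimes>\<^bsub>?G\<^esub> (y \<otimes>\<^bsub>?G\<^esub> z)"
    unfolding xyz by (simp only: mult_presented_group uvw words_append append_assoc simp_thms)
next
  show "\<one>\<^bsub>?G\<^esub> \<in> carrier ?G"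
    unfolding carrier_presented_group one_presented_group by (intro imageI) simp
next
  fix x assume "x \<in> carrier ?G"
  then obtain w where w: "w \<in> words S" and x: "x = word_class S R w"
    unfolding carrier_presented_group by blast
  show "\<one>\<^bsub>?G\<^esub> \<otimes>\<^bsub>?G\<^esub> x = x"
    unfolding x one_presented_group by (subst mult_presented_group) (simp_all add: w)
  have "word_class S R (winv w) \<otimes>\<^bsub>?G\<^esub> x = word_class S R (winv w @ w)"
    unfolding x using w by (intro mult_presented_group winv_words)
  also have "\<dots> = \<one>\<^bsub>?G\<^esub>"
    unfolding one_presented_group
    using w by (subst word_class_eq_iff) (simp_all add: winv_words word_cong_winv)
  finally show "\<exists>y\<in>carrier ?G. y \<otimes>\<^bsub>?G\<^esub> x = \<one>\<^bsub>?G\<^esub>"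
    unfolding carrier_presented_group using w winv_words by blast
qed


section \<open>Affine Cartan matrices\<close>

text \<open>A matrix \<open>(a\<^sub>i\<^sub>j)\<close> with \<open>0 \<le> i, j \<le> n\<close> is a function on pairs of indices, of which only the
  values at indices \<open>\<le> n\<close> matter.\<close>

definition generalized_cartan_matrix :: "nat \<Rightarrow> (nat \<Rightarrow> nat \<Rightarrow> int) \<Rightarrow> bool" where
  "generalized_cartan_matrix n A \<longleftrightarrow>
    (\<forall>i\<le>n. A i i = 2) \<and>
    (\<forall>i\<le>n. \<forall>j\<le>n. i \<noteq> j \<longrightarrow> A i j \<le> 0) \<and>
    (\<forall>i\<le>n. \<forall>j\<le>n. A i j = 0 \<longrightarrow> A j i = 0)"

definition irreducible_matrix :: "nat \<Rightarrow> (nat \<Rightarrow> nat \<Rightarrow> int) \<Rightarrow> bool" where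
  "irreducible_matrix n A \<longleftrightarrow>
    \<not> (\<exists>I. I \<noteq> {} \<and> I \<subset> {..n} \<and> (\<forall>i\<in>I. \<forall>j\<in>{..n} - I. A i j = 0 \<and> A j i = 0))"

definition mat_vec :: "nat \<Rightarrow> (nat \<Rightarrow> nat \<Rightarrow> int) \<Rightarrow> (nat \<Rightarrow> real) \<Rightarrow> nat \<Rightarrow> real" where
  "mat_vec n A v i = (\<Sum>j\<le>n. of_int (A i j) * v j)"

text \<open>Kac's condition (Aff): there is a vector \<open>u > 0\<close> with \<open>A u = 0\<close>, the corank of \<open>A\<close> is \<open>1\<close>
  (that is, the kernel is the line spanned by \<open>u\<close>), and \<open>A v \<ge> 0\<close> implies \<open>A v = 0\<close>.\<close>

definition affine_matrix :: "nat \<Rightarrow> (nat \<Rightarrow> nat \<Rightarrow> int) \<Rightarrow> bool" where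
  "affine_matrix n A \<longleftrightarrow>
    (\<exists>u. (\<forall>i\<le>n. 0 < u i) \<and> (\<forall>i\<le>n. mat_vec n A u i = 0) \<and>
       (\<forall>v. (\<forall>i\<le>n. mat_vec n A v i = 0) \<longrightarrow> (\<exists>c. \<forall>i\<le>n. v i = c * u i))) \<and>
    (\<forall>v. (\<forall>i\<le>n. 0 \<le> mat_vec n A v i) \<longrightarrow> (\<forall>i\<le>n. mat_vec n A v i = 0))"

definition irreducible_affine_cartan_matrix :: "nat \<Rightarrow> (nat \<Rightarrow> nat \<Rightarrow> int) \<Rightarrow> bool" where
  "irreducible_affine_cartan_matrix n A \<longleftrightarrow>
    generalized_cartan_matrix n A \<and> irreducible_matrix n A \<and> affine_matrix n A"

text \<open>The types, with the node labels, of Kac, Infinite dimensional Lie algebras, Tables Aff 1-3.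
  The constructor \<open>X_1\<close> stands for the untwisted type \<open>X\<^sup>(\<^sup>1\<^sup>)\<close>; the twisted types are
  \<open>A_even_2 l\<close> for \<open>A\<^sub>2\<^sub>l\<^sup>(\<^sup>2\<^sup>)\<close>, \<open>A_odd_2 l\<close> for \<open>A\<^sub>2\<^sub>l\<^sub>-\<^sub>1\<^sup>(\<^sup>2\<^sup>)\<close>, \<open>D_2 l\<close> for \<open>D\<^sub>l\<^sub>+\<^sub>1\<^sup>(\<^sup>2\<^sup>)\<close>,
  \<open>E6_2\<close> for \<open>E\<^sub>6\<^sup>(\<^sup>2\<^sup>)\<close> and \<open>D4_3\<close> for \<open>D\<^sub>4\<^sup>(\<^sup>3\<^sup>)\<close>.\<close>

datatype kac_type =
    A_1 nat | B_1 nat | C_1 nat | D_1 nat | E6_1 | E7_1 | E8_1 | F4_1 | G2_1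
  | A_even_2 nat | A_odd_2 nat | D_2 nat | E6_2 | D4_3

fun kac_rank :: "kac_type \<Rightarrow> nat" where
  "kac_rank (A_1 l) = l"
| "kac_rank (B_1 l) = l"
| "kac_rank (C_1 l) = l"
| "kac_rank (D_1 l) = l"
| "kac_rank E6_1 = 6"
| "kac_rank E7_1 = 7"
| "kac_rank E8_1 = 8"
| "kac_rank F4_1 = 4"
| "kac_rank G2_1 = 2"
| "kac_rank (A_even_2 l) = l"
| "kac_rank (A_odd_2 l) = l"
| "kac_rank (D_2 l) = l"
| "kac_rank E6_2 = 4"
| "kac_rank D4_3 = 2"

fun kac_admissible :: "kac_type \<Rightarrow> bool" where
  "kac_admissible (A_1 l) = (l \<ge> 1)"
| "kac_admissible (B_1 l) = (l \<ge> 3)"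
| "kac_admissible (C_1 l) = (l \<ge> 2)"
| "kac_admissible (D_1 l) = (l \<ge> 4)"
| "kac_admissible (A_even_2 l) = (l \<ge> 1)"
| "kac_admissible (A_odd_2 l) = (l \<ge> 3)"
| "kac_admissible (D_2 l) = (l \<ge> 2)"
| "kac_admissible _ = True"

text \<open>An entry \<open>(i, j, p, q)\<close> records the edge of the diagram with \<open>a\<^sub>i\<^sub>j = p\<close> and \<open>a\<^sub>j\<^sub>i = q\<close>.\<close>

type_synonym edge = "nat \<times> nat \<times> int \<times> int"

definition lace :: "nat \<Rightarrow> nat \<Rightarrow> edge" where
  "lace i j = (i, j, -1, -1)"

definition chain :: "nat \<Rightarrow> nat \<Rightarrow> edge list" where
  "chain i j = map (\<lambda>k. lace k (Suc k)) [i..<j]"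

fun kac_edges :: "kac_type \<Rightarrow> edge list" where
  "kac_edges (A_1 l) = (if l = 1 then [(0, 1, -2, -2)] else lace l 0 # chain 0 l)"
| "kac_edges (B_1 l) = lace 0 2 # chain 1 (l - 1) @ [(l - 1, l, -1, -2)]"
| "kac_edges (C_1 l) = (0, 1, -1, -2) # chain 1 (l - 1) @ [(l - 1, l, -2, -1)]"
| "kac_edges (D_1 l) = lace 0 2 # chain 1 (l - 1) @ [lace (l - 2) l]"
| "kac_edges E6_1 = chain 1 5 @ [lace 3 6, lace 6 0]"
| "kac_edges E7_1 = chain 0 6 @ [lace 3 7]"
| "kac_edges E8_1 = chain 0 7 @ [lace 5 8]"
| "kac_edges F4_1 = chain 0 2 @ [(2, 3, -1, -2), lace 3 4]"
| "kac_edges G2_1 = [lace 0 1, (1, 2, -1, -3)]"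
| "kac_edges (A_even_2 l) = (if l = 1 then [(0, 1, -4, -1)]
     else (0, 1, -2, -1) # chain 1 (l - 1) @ [(l - 1, l, -2, -1)])"
| "kac_edges (A_odd_2 l) = lace 0 2 # chain 1 (l - 1) @ [(l - 1, l, -2, -1)]"
| "kac_edges (D_2 l) = (0, 1, -2, -1) # chain 1 (l - 1) @ [(l - 1, l, -1, -2)]"
| "kac_edges E6_2 = chain 0 2 @ [(2, 3, -2, -1), lace 3 4]"
| "kac_edges D4_3 = [lace 0 1, (1, 2, -3, -1)]"

definition kac_matrix :: "kac_type \<Rightarrow> nat \<Rightarrow> nat \<Rightarrow> int" where
  "kac_matrix X i j =
    (if i = j then 2
     else case map_of (concat (map (\<lambda>(i, j, p, q). [((i, j), p), ((j, i), q)]) (kac_edges X))) (i, j)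
       of Some a \<Rightarrow> a | None \<Rightarrow> 0)"

definition of_kac_type :: "nat \<Rightarrow> (nat \<Rightarrow> nat \<Rightarrow> int) \<Rightarrow> kac_type \<Rightarrow> bool" where
  "of_kac_type n A X \<longleftrightarrow>
    kac_admissible X \<and> n = kac_rank X \<and> (\<forall>i\<le>n. \<forall>j\<le>n. A i j = kac_matrix X i j)"

definition labelled_as_in_Kac :: "nat \<Rightarrow> (nat \<Rightarrow> nat \<Rightarrow> int) \<Rightarrow> bool" where
  "labelled_as_in_Kac n A \<longleftrightarrow> (\<exists>X. of_kac_type n A X)"


section \<open>The triple group\<close>

definition laces :: "(nat \<Rightarrow> nat \<Rightarrow> int) \<Rightarrow> nat \<Rightarrow> nat \<Rightarrow> int" where
  "laces A i j = A i j * A j i"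

datatype triple_gen = T nat | T01 | T02 | T03

fun node :: "triple_gen \<Rightarrow> nat" where
  "node (T i) = i"
| "node T01 = 0"
| "node T02 = 0"
| "node T03 = 0"

definition triple_gens :: "nat \<Rightarrow> triple_gen set" where
  "triple_gens n = T ` {1..n} \<union> {T01, T02, T03}"

definition D_word :: "triple_gen word" where
  "D_word = wgen T01 @ wgen T02 @ wgen T03"

text \<open>\<open>alternating m x y\<close> is \<open>x y x \<dots>\<close> with \<open>m\<close> factors.\<close>

fun alternating :: "nat \<Rightarrow> 'g word \<Rightarrow> 'g word \<Rightarrow> 'g word" where
  "alternating 0 x y = []"
| "alternating (Suc m) x y = x @ alternating m y x"

definition braid_relation :: "nat \<Rightarrow> 'g word \<Rightarrow> 'g word \<Rightarrow> 'g word \<times> 'g word" where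
  "braid_relation m x y = (alternating m x y, alternating m y x)"

text \<open>Nodes connected by \<open>4\<close> laces (types \<open>A_1 1\<close> and \<open>A_even_2 1\<close>) give no braid relation.\<close>

definition triple_rels_a :: "nat \<Rightarrow> (nat \<Rightarrow> nat \<Rightarrow> int) \<Rightarrow> (triple_gen word \<times> triple_gen word) set" where
  "triple_rels_a n A =
    {braid_relation m (wgen g) (wgen h) | g h m.
       g \<in> triple_gens n \<and> h \<in> triple_gens n \<and> node g \<noteq> node h \<and>
       (laces A (node g) (node h), m) \<in> {(0, 2), (1, 3), (2, 4), (3, 6)}}"

definition triple_rels_b :: "nat \<Rightarrow> (nat \<Rightarrow> nat \<Rightarrow> int) \<Rightarrow> (triple_gen word \<times> triple_gen word) set" where
  "triple_rels_b n A =
    {braid_relation 3 x (wpow D_word k @ wgen (T \<alpha>) @ wpow D_word (- k)) | x \<alpha> k.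
       \<alpha> \<in> {1..n} \<and> laces A 0 \<alpha> = 1 \<and>
       x \<in> {wgen T01, wgen T02, wgen T03,
            wgen T01 @ wgen T02 @ winv (wgen T01),
            winv (wgen T03) @ wgen T02 @ wgen T03}}"

definition triple_rels_c :: "nat \<Rightarrow> (nat \<Rightarrow> nat \<Rightarrow> int) \<Rightarrow> (triple_gen word \<times> triple_gen word) set" where
  "triple_rels_c n A =
    {(wgen g @ winv (wgen (T \<alpha>)) @ wgen h @ wgen (T \<alpha>),
      winv (wgen (T \<alpha>)) @ wgen h @ wgen (T \<alpha>) @ wgen g) | g h \<alpha>.
       \<alpha> \<in> {1..n} \<and> laces A 0 \<alpha> = 2 \<and> (g, h) \<in> {(T01, T02), (T01, T03), (T02, T03)}}"

definition triple_rels :: "nat \<Rightarrow> (nat \<Rightarrow> nat \<Rightarrow> int) \<Rightarrow> (triple_gen word \<times> triple_gen word) set" where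
  "triple_rels n A = triple_rels_a n A \<union> triple_rels_b n A \<union> triple_rels_c n A"

definition triple_group :: "nat \<Rightarrow> (nat \<Rightarrow> nat \<Rightarrow> int) \<Rightarrow> triple_gen word set monoid" where
  "triple_group n A = presented_group (triple_gens n) (triple_rels n A)"

definition triple_class :: "nat \<Rightarrow> (nat \<Rightarrow> nat \<Rightarrow> int) \<Rightarrow> triple_gen word \<Rightarrow> triple_gen word set" where
  "triple_class n A = word_class (triple_gens n) (triple_rels n A)"

fun assign_a :: "triple_gen \<Rightarrow> triple_gen word" where
  "assign_a (T i) = wgen (T i)"
| "assign_a T03 = wgen T03"
| "assign_a T01 = wgen T02"
| "assign_a T02 = winv (wgen T02) @ wgen T01 @ wgen T02"

fun assign_b :: "triple_gen \<Rightarrow> triple_gen word" where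
  "assign_b (T i) = wgen (T i)"
| "assign_b T01 = wgen T01"
| "assign_b T02 = wgen T03"
| "assign_b T03 = winv (wgen T03) @ wgen T02 @ wgen T03"

definition extends_assignment ::
  "nat \<Rightarrow> (nat \<Rightarrow> nat \<Rightarrow> int) \<Rightarrow> (triple_gen \<Rightarrow> triple_gen word)
    \<Rightarrow> (triple_gen word set \<Rightarrow> triple_gen word set) \<Rightarrow> bool" where
  "extends_assignment n A f \<phi> \<longleftrightarrow>
    (\<forall>g\<in>triple_gens n. \<phi> (triple_class n A (wgen g)) = triple_class n A (f g))"


section \<open>The braid group on three letters\<close>

datatype braid_gen = BrA | BrB

definition braid3_rels :: "(braid_gen word \<times> braid_gen word) set" where
  "braid3_rels =
    {(wgen BrA @ wgen BrB @ wgen BrA, wgen BrB @ wgen BrA @ wgen BrB)}"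

definition braid3 :: "braid_gen word set monoid" where
  "braid3 = presented_group UNIV braid3_rels"

definition braid3_gen :: "braid_gen \<Rightarrow> braid_gen word set" where
  "braid3_gen x = word_class UNIV braid3_rels (wgen x)"

end

theory Submission
  imports Defs
begin

text \<open>On the triple \<open>(x, y, z) = (T01, T02, T03)\<close> the two assignments are the Hurwitz moves; they and their
  inverse moves leave \<open>D = x y z\<close> fixed. It suffices that each of these four moves preserves the
  defining relations between the triple and a node \<open>t\<close>: then all of them extend to endomorphisms,
  the extensions of inverse moves are mutually inverse, and the braid relation is checked on
  generators.

  For a double lace this follows from one statement about a pair \<open>x, y\<close>, in which the relation of
  four factors \<open>x t x t = t x t x\<close> is used in the form \<open>t\<inverse> x t = x (t x t\<inverse>) x\<inverse>\<close>. For a single lace, if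
  \<open>x\<close> and \<open>y\<close> satisfy the braid relation with \<open>t\<close>, then \<open>x y x\<inverse>\<close> satisfies it if and only if
  \<open>y\<inverse> x y\<close> does. The set of elements satisfying it with all the \<open>D\<^sup>k t D\<^sup>-\<^sup>k\<close> is moreover stable under
  conjugation by \<open>D\<close>, and these two facts generate all the required elements from the five
  in relation b).\<close>

section \<open>Braid relations and conjugation\<close>

context group
begin

definition conjugate :: "'a \<Rightarrow> 'a \<Rightarrow> 'a" where
  "conjugate g x = g \<otimes> x \<otimes> inv g"

definition single_lace_rel :: "'a \<Rightarrow> 'a \<Rightarrow> bool" where
  "single_lace_rel x y \<longleftrightarrow> x \<otimes> y \<otimes> x = y \<otimes> x \<otimes> y"

definition double_lace_rel :: "'a \<Rightarrow> 'a \<Rightarrow> bool" where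
  "double_lace_rel x y \<longleftrightarrow> x \<otimes> y \<otimes> x \<otimes> y = y \<otimes> x \<otimes> y \<otimes> x"

definition commuting :: "'a \<Rightarrow> 'a \<Rightarrow> bool" where
  "commuting x y \<longleftrightarrow> x \<otimes> y = y \<otimes> x"

lemma inv_cancel_left:
  "x \<in> carrier G \<Longrightarrow> y \<in> carrier G \<Longrightarrow> inv x \<otimes> (x \<otimes> y) = y"
  "x \<in> carrier G \<Longrightarrow> y \<in> carrier G \<Longrightarrow> x \<otimes> (inv x \<otimes> y) = y"
  by (simp_all flip: m_assoc)

lemmas word_simps = m_assoc inv_mult_group inv_cancel_left

lemma conjugate_closed [simp]: "g \<in> carrier G \<Longrightarrow> x \<in> carrier G \<Longrightarrow> conjugate g x \<in> carrier G"
  by (simp add: conjugate_def)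

lemma conjugate_mult:
  "\<lbrakk>g \<in> carrier G; x \<in> carrier G; y \<in> carrier G\<rbrakk>
    \<Longrightarrow> conjugate g (x \<otimes> y) = conjugate g x \<otimes> conjugate g y"
  by (simp add: conjugate_def word_simps)

lemma conjugate_conjugate:
  "\<lbrakk>g \<in> carrier G; h \<in> carrier G; x \<in> carrier G\<rbrakk>
    \<Longrightarrow> conjugate g (conjugate h x) = conjugate (g \<otimes> h) x"
  by (simp add: conjugate_def word_simps)

lemma conjugate_eq_iff:
  "\<lbrakk>g \<in> carrier G; x \<in> carrier G; y \<in> carrier G\<rbrakk> \<Longrightarrow> conjugate g x = conjugate g y \<longleftrightarrow> x = y"
  by (simp add: conjugate_def)

lemma conjugate_inv_cancel [simp]:
  "g \<in> carrier G \<Longrightarrow> x \<in> carrier G \<Longrightarrow> conjugate (inv g) (conjugate g x) = x"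
  "g \<in> carrier G \<Longrightarrow> x \<in> carrier G \<Longrightarrow> conjugate g (conjugate (inv g) x) = x"
  by (simp_all add: conjugate_def word_simps)

text \<open>All three relations are equations between words, and conjugation by \<open>g\<close> is
  an injective homomorphism.\<close>

lemma rel_conjugate_iff:
  assumes [simp]: "g \<in> carrier G" "x \<in> carrier G" "y \<in> carrier G"
  shows "single_lace_rel (conjugate g x) (conjugate g y) \<longleftrightarrow> single_lace_rel x y"
    and "double_lace_rel (conjugate g x) (conjugate g y) \<longleftrightarrow> double_lace_rel x y"
    and "commuting (conjugate g x) (conjugate g y) \<longleftrightarrow> commuting x y"
  by (simp_all add: single_lace_rel_def double_lace_rel_def commuting_def conjugate_eq_iff
    flip: conjugate_mult)

text \<open>Conjugating both arguments at once moves a conjugation from one argument to the other.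
  Most later manipulations of relations proceed by such moves.\<close>

lemma rel_conjugate_shift:
  assumes [simp]: "g \<in> carrier G" "x \<in> carrier G" "y \<in> carrier G"
  shows "single_lace_rel (conjugate g x) y \<longleftrightarrow> single_lace_rel x (conjugate (inv g) y)"
    and "double_lace_rel (conjugate g x) y \<longleftrightarrow> double_lace_rel x (conjugate (inv g) y)"
    and "commuting (conjugate g x) y \<longleftrightarrow> commuting x (conjugate (inv g) y)"
  using rel_conjugate_iff[of g x "conjugate (inv g) y"] by simp_all

lemma rel_sym:
  "single_lace_rel x y \<Longrightarrow> single_lace_rel y x" "double_lace_rel x y \<Longrightarrow> double_lace_rel y x"
  "commuting x y \<Longrightarrow> commuting y x"
  by (simp_all add: single_lace_rel_def double_lace_rel_def commuting_def)

text \<open>Multiplication by \<open>x\<close> on the left and by \<open>y\<close> on the right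
  turns the two sides into \<open>y x y\<close> and \<open>x y x\<close>.\<close>

lemma single_lace_conjugate:
  assumes [simp]: "x \<in> carrier G" "y \<in> carrier G" and xy: "single_lace_rel x y"
  shows "conjugate (inv x) y = conjugate y x"
proof -
  have "x \<otimes> conjugate (inv x) y \<otimes> y = x \<otimes> conjugate y x \<otimes> y"
    using xy by (simp add: single_lace_rel_def conjugate_def word_simps)
  then show ?thesis by simp
qed

text \<open>By \<open>single_lace_conjugate\<close>, conjugating \<open>t\<close> by
  \<open>inv x\<close> amounts to conjugating \<open>x\<close> by \<open>t\<close>, and conjugating
  \<open>y\<close> by \<open>inv t\<close> to conjugating \<open>t\<close> by \<open>y\<close>.
  Alternating these exchanges with moves across the relation carries one side of the equivalence to
  the other.\<close>

lemma single_lace_conjugate_iff: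
  assumes [simp]: "x \<in> carrier G" "y \<in> carrier G" "t \<in> carrier G"
    and xt: "single_lace_rel x t" and yt: "single_lace_rel y t"
  shows "single_lace_rel (conjugate x y) t \<longleftrightarrow> single_lace_rel (conjugate (inv y) x) t"
proof -
  have "single_lace_rel (conjugate x y) t \<longleftrightarrow> single_lace_rel y (conjugate t x)"
    using single_lace_conjugate[OF _ _ xt] by (simp add: rel_conjugate_shift)
  also have "\<dots> \<longleftrightarrow> single_lace_rel (conjugate (inv t) y) x"
    by (simp add: rel_conjugate_shift)
  also have "\<dots> \<longleftrightarrow> single_lace_rel (conjugate y t) x"
    using single_lace_conjugate[OF _ _ rel_sym(1)[OF yt]] by simp
  also have "\<dots> \<longleftrightarrow> single_lace_rel (conjugate (inv y) x) t"
    using rel_conjugate_shift(1)[of "inv y" x t] rel_sym(1) by auto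
  finally show ?thesis .
qed

text \<open>Multiplied by \<open>t\<close> on the left and by \<open>x t\<close> on the right, the
  two conjugates become \<open>x t x t\<close> and \<open>t x t x\<close>.\<close>

lemma double_lace_iff:
  assumes [simp]: "x \<in> carrier G" "t \<in> carrier G"
  shows "double_lace_rel x t \<longleftrightarrow> conjugate (inv t) x = conjugate x (conjugate t x)"
proof -
  have "x \<otimes> t \<otimes> x \<otimes> t = t \<otimes> conjugate x (conjugate t x) \<otimes> x \<otimes> t"
    "t \<otimes> x \<otimes> t \<otimes> x = t \<otimes> conjugate (inv t) x \<otimes> x \<otimes> t" if "double_lace_rel x t"
    using that by (simp_all add: double_lace_rel_def conjugate_def word_simps)
  moreover have "x \<otimes> t \<otimes> x \<otimes> t = t \<otimes> conjugate (inv t) x \<otimes> x \<otimes> t"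
    by (simp add: conjugate_def word_simps)
  moreover have "t \<otimes> x \<otimes> t \<otimes> x = t \<otimes> conjugate x (conjugate t x) \<otimes> x \<otimes> t"
    by (simp add: conjugate_def word_simps)
  ultimately show ?thesis
    unfolding double_lace_rel_def by simp
qed

lemma commuting_conjugate_eq:
  "\<lbrakk>commuting x y; x \<in> carrier G; y \<in> carrier G\<rbrakk> \<Longrightarrow> conjugate x y = y"
  by (simp add: commuting_def conjugate_def word_simps)

lemma commuting_inv:
  "\<lbrakk>commuting x y; x \<in> carrier G; y \<in> carrier G\<rbrakk> \<Longrightarrow> commuting (inv x) y"
  unfolding commuting_def by (metis inv_closed inv_solve_left inv_solve_right m_assoc m_closed)

text \<open>Conjugation by \<open>g\<close> fixes \<open>u\<close>, so a conjugation of
  \<open>x\<close> by \<open>g\<close> or \<open>inv g\<close> disappears once it is moved to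
  \<open>u\<close>.\<close>

lemma commuting_conjugate:
  assumes "commuting g u" "commuting x u"
    and [simp]: "g \<in> carrier G" "x \<in> carrier G" "u \<in> carrier G"
  shows "commuting (conjugate g x) u" "commuting (conjugate (inv g) x) u"
proof -
  have *: "conjugate (inv g) u = u" "conjugate g u = u"
    using assms commuting_inv commuting_conjugate_eq by auto
  show "commuting (conjugate g x) u" "commuting (conjugate (inv g) x) u"
    using assms(2) by (simp_all add: rel_conjugate_shift *)
qed

lemma conjugate_of_conjugate:
  "\<lbrakk>g \<in> carrier G; h \<in> carrier G; x \<in> carrier G\<rbrakk>
    \<Longrightarrow> conjugate (conjugate g h) (conjugate g x) = conjugate g (conjugate h x)"
  "\<lbrakk>g \<in> carrier G; h \<in> carrier G; x \<in> carrier G\<rbrakk>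
    \<Longrightarrow> conjugate (inv (conjugate g h)) (conjugate g x) = conjugate g (conjugate (inv h) x)"
  by (simp_all add: conjugate_def word_simps)

section \<open>Pairs of elements under the relations of a double lace\<close>

context
  fixes x y t
  assumes carr [simp]: "x \<in> carrier G" "y \<in> carrier G" "t \<in> carrier G"
    and xt: "double_lace_rel x t" and yt: "double_lace_rel y t"
    and xy: "commuting x (conjugate (inv t) y)"
begin

text \<open>By the double lace relation, \<open>t^-1 y t\<close> equals
  \<open>y (t y t^-1) y^-1\<close>. It commutes with \<open>x\<close>, and its outer conjugations by
  \<open>y\<close> and \<open>t\<close> can be moved to \<open>x\<close>. The result is relation c)
  for the pair \<open>y\<close>, \<open>y^-1 x y\<close>.\<close>

lemma commuting_conjugate_right:
  "commuting y (conjugate (inv t) (conjugate (inv y) x))"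
proof -
  have "commuting (conjugate y (conjugate t y)) x"
    using xy yt by (auto simp: double_lace_iff intro: rel_sym)
  then show ?thesis
    by (simp add: rel_conjugate_shift)
qed

text \<open>Since \<open>x\<close> commutes with \<open>t^-1 y t\<close>, the element
  \<open>t x t^-1\<close> commutes with \<open>y\<close>. Conjugation by \<open>x\<close> turns
  \<open>t x t^-1\<close> into \<open>t^-1 x t\<close>, which gives relation c) for the pair
  \<open>x y x^-1\<close>, \<open>x\<close>.\<close>

lemma commuting_conjugate_left: "commuting (conjugate x y) (conjugate (inv t) x)"
proof -
  have "commuting (conjugate t x) y"
    using xy by (simp add: rel_conjugate_shift)
  then have "commuting (conjugate x y) (conjugate x (conjugate t x))"
    by (auto simp: rel_conjugate_iff intro: rel_sym)
  then show ?thesis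
    using xt by (simp add: double_lace_iff)
qed

text \<open>Two commutations, of \<open>?w\<close> with \<open>t y t^-1\<close> and of
  \<open>y\<close> with \<open>t x t^-1\<close>, allow the conjugating element to be rearranged
  until the relation between \<open>x\<close> and \<open>t\<close> applies.\<close>

lemma double_lace_conjugate_right: "double_lace_rel (conjugate (inv y) x) t"
proof -
  let ?w = "conjugate (inv y) x"
  have wQ: "commuting ?w (conjugate t y)"
    using xy yt by (simp add: rel_conjugate_shift double_lace_iff)
  have yP: "conjugate y (conjugate t x) = conjugate t x"
    using commuting_conjugate_eq[of y "conjugate t x"] rel_sym(3)[OF xy]
      rel_conjugate_shift(3)[of "inv t" y x] by simp
  \<comment> \<open>\<open>t ?w t^-1\<close> is the conjugate of \<open>t x t^-1\<close> by
    \<open>(t y t^-1)^-1\<close>, so the conjugating elements collect in one factor.\<close>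
  have "conjugate ?w (conjugate t ?w)
      = conjugate (?w \<otimes> inv (conjugate t y)) (conjugate t x)"
    by (simp add: conjugate_of_conjugate flip: conjugate_conjugate)
  also have "?w \<otimes> inv (conjugate t y) = inv (conjugate t y) \<otimes> ?w"
    using commuting_inv[OF rel_sym(3)[OF wQ]] by (simp add: commuting_def)
  also have "\<dots> = inv (y \<otimes> conjugate t y) \<otimes> x \<otimes> y"
    by (simp add: conjugate_def word_simps)
  also have "y \<otimes> conjugate t y = conjugate (inv t) y \<otimes> y"
    using yt by (simp add: double_lace_iff) (simp add: conjugate_def word_simps)
  also have "conjugate (inv (conjugate (inv t) y \<otimes> y) \<otimes> x \<otimes> y) (conjugate t x)
      = conjugate (inv y) (conjugate (inv (conjugate (inv t) y)) (conjugate x (conjugate t x)))"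
    using yP by (simp add: inv_mult_group flip: conjugate_conjugate)
  also have "conjugate x (conjugate t x) = conjugate (inv t) x"
    using xt by (simp add: double_lace_iff)
  \<comment> \<open>The inner conjugations produce \<open>t^-1 ?w t\<close>; this commutes with
    \<open>y\<close>, so the outer conjugation by \<open>inv y\<close> has no effect.\<close>
  also have "conjugate (inv y) (conjugate (inv (conjugate (inv t) y)) (conjugate (inv t) x))
      = conjugate (inv t) ?w"
    using commuting_conjugate_right
    by (simp add: conjugate_of_conjugate commuting_inv commuting_conjugate_eq)
  finally show ?thesis
    by (simp add: double_lace_iff)
qed

text \<open>Conjugation by \<open>x y\<close> carries \<open>t x t^-1\<close> to
  \<open>t^-1 x t\<close> and \<open>t y t^-1\<close> to \<open>t^-1 y t\<close>, hence
  \<open>t ?v t^-1\<close> to \<open>t^-1 ?v t\<close>. Conjugation by \<open>?v = x y x^-1\<close>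
  does the same to \<open>t ?v t^-1\<close>, because \<open>x\<close> commutes with that
  element.\<close>

lemma double_lace_conjugate_left: "double_lace_rel (conjugate x y) t"
proof -
  let ?v = "conjugate x y"
  have x_v: "commuting x (conjugate t ?v)"
    using commuting_conjugate_left rel_sym(3) rel_conjugate_shift(3)[of "inv t" x ?v] by auto
  have yP: "conjugate y (conjugate t x) = conjugate t x"
    using commuting_conjugate_eq[of y "conjugate t x"] rel_sym(3)[OF xy]
      rel_conjugate_shift(3)[of "inv t" y x] by simp
  have "conjugate ?v (conjugate t ?v) = conjugate x (conjugate y (conjugate (inv x) (conjugate t ?v)))"
    by (simp add: conjugate_def word_simps)
  also have "conjugate (inv x) (conjugate t ?v) = conjugate t ?v"
    using x_v by (simp add: commuting_inv commuting_conjugate_eq)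
  also have "conjugate x (conjugate y (conjugate t ?v))
      = conjugate (conjugate x (conjugate y (conjugate t x))) (conjugate x (conjugate y (conjugate t y)))"
    by (simp add: conjugate_of_conjugate)
  also have "\<dots> = conjugate (conjugate (inv t) x) (conjugate x (conjugate (inv t) y))"
    using xt yt by (simp add: yP double_lace_iff)
  also have "\<dots> = conjugate (inv t) ?v"
    using xy by (simp add: commuting_conjugate_eq conjugate_of_conjugate)
  finally show ?thesis
    by (simp add: double_lace_iff)
qed

end

text \<open>\<open>L\<close> is the number of laces between the affine node and the node of \<open>t\<close>. There is no clause for
  \<open>L = 3\<close>, which never occurs at the affine node.\<close>

definition triple_relations_at :: "int \<Rightarrow> 'a \<Rightarrow> 'a \<Rightarrow> 'a \<Rightarrow> 'a \<Rightarrow> bool" where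
  "triple_relations_at L t x y z \<longleftrightarrow>
    (L = 0 \<longrightarrow> commuting x t \<and> commuting y t \<and> commuting z t) \<and>
    (L = 1 \<longrightarrow> (\<forall>u\<in>{x, y, z, conjugate x y, conjugate (inv z) y}. \<forall>k::int.
       single_lace_rel u (conjugate ((x \<otimes> y \<otimes> z) [^] k) t))) \<and>
    (L = 2 \<longrightarrow> double_lace_rel x t \<and> double_lace_rel y t \<and> double_lace_rel z t \<and>
       commuting x (conjugate (inv t) y) \<and> commuting x (conjugate (inv t) z) \<and>
       commuting y (conjugate (inv t) z))"

text \<open>Moving \<open>d\<close> across the relation replaces \<open>k\<close> by
  \<open>k - 1\<close>, and \<open>k\<close> runs through all integers.\<close>

lemma single_lace_conjugate_powers:
  assumes [simp]: "d \<in> carrier G" "t \<in> carrier G" "u \<in> carrier G"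
  shows "(\<forall>k::int. single_lace_rel (conjugate d u) (conjugate (d [^] k) t)) \<longleftrightarrow>
    (\<forall>k::int. single_lace_rel u (conjugate (d [^] k) t))"
proof -
  have *: "single_lace_rel (conjugate d u) (conjugate (d [^] k) t)
      \<longleftrightarrow> single_lace_rel u (conjugate (d [^] (k - 1)) t)" for k :: int
  proof -
    have "inv d \<otimes> d [^] k = d [^] (k - 1)"
      using int_pow_mult[of d "-1" k] by (simp add: int_pow_neg)
    then show ?thesis
      by (simp add: rel_conjugate_shift conjugate_conjugate)
  qed
  show ?thesis
    unfolding * by (metis add_diff_cancel_right')
qed

section \<open>The four Hurwitz moves and the relations at one node\<close>

context
  fixes t x y z
  assumes carr [simp]: "t \<in> carrier G" "x \<in> carrier G" "y \<in> carrier G" "z \<in> carrier G"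
begin

text \<open>The invariance of \<open>D\<close> makes the conjugates of \<open>t\<close> in relation
  b) the same for the old and the new triple.\<close>

lemma hurwitz_product:
  "y \<otimes> conjugate (inv y) x \<otimes> z = x \<otimes> y \<otimes> z"
  "conjugate x y \<otimes> x \<otimes> z = x \<otimes> y \<otimes> z"
  "x \<otimes> z \<otimes> conjugate (inv z) y = x \<otimes> y \<otimes> z"
  "x \<otimes> conjugate y z \<otimes> y = x \<otimes> y \<otimes> z"
  by (simp_all add: conjugate_def word_simps)

lemma triple_relations_at_0_hurwitz:
  assumes "triple_relations_at 0 t x y z"
  shows "triple_relations_at 0 t y (conjugate (inv y) x) z"
    and "triple_relations_at 0 t (conjugate x y) x z"
    and "triple_relations_at 0 t x z (conjugate (inv z) y)"
    and "triple_relations_at 0 t x (conjugate y z) y"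
  using assms by (simp_all add: triple_relations_at_def commuting_conjugate)

lemma triple_relations_at_2_hurwitz:
  assumes "triple_relations_at 2 t x y z"
  shows "triple_relations_at 2 t y (conjugate (inv y) x) z"
    and "triple_relations_at 2 t (conjugate x y) x z"
    and "triple_relations_at 2 t x z (conjugate (inv z) y)"
    and "triple_relations_at 2 t x (conjugate y z) y"
proof -
  \<comment> \<open>Needed for the moves of \<open>y\<close> and \<open>z\<close>: conjugation by
    \<open>inv t\<close> turns the new entry into a conjugate of \<open>t^-1 y t\<close> by
    \<open>(t^-1 z t)^-1\<close>, or of \<open>t^-1 z t\<close> by \<open>t^-1 y t\<close>, and
    \<open>x\<close> commutes with both of these elements.\<close>
  have *: "commuting x (conjugate (inv t) (conjugate (inv z) y))"
    "commuting x (conjugate (inv t) (conjugate y z))"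
    if "commuting x (conjugate (inv t) y)" "commuting x (conjugate (inv t) z)"
    using that commuting_conjugate[of "conjugate (inv t) z" x "conjugate (inv t) y"]
      commuting_conjugate[of "conjugate (inv t) y" x "conjugate (inv t) z"]
    by (simp_all add: conjugate_of_conjugate rel_sym)
  show "triple_relations_at 2 t y (conjugate (inv y) x) z"
    "triple_relations_at 2 t (conjugate x y) x z"
    "triple_relations_at 2 t x z (conjugate (inv z) y)"
    "triple_relations_at 2 t x (conjugate y z) y"
    using assms *
    by (simp_all add: triple_relations_at_def commuting_conjugate commuting_conjugate_left
      commuting_conjugate_right double_lace_conjugate_left double_lace_conjugate_right)
qed

text \<open>For a new triple \<open>x', y', z'\<close> relation b) also concerns
  \<open>x' y' x'^-1\<close> and \<open>z'^-1 y' z'\<close>. In the order of the moves these are: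
  \<open>x\<close> and \<open>z^-1 y^-1 x y z\<close>; \<open>(x y) x (x y)^-1\<close> and
  \<open>z^-1 x z\<close>; \<open>x z x^-1\<close> and the conjugate of \<open>z\<close> by the
  inverse of \<open>z^-1 y z\<close>; \<open>x y z y^-1 x^-1\<close> and \<open>z\<close>.\<close>

lemma triple_relations_at_1_hurwitz:
  assumes "triple_relations_at 1 t x y z"
  shows "triple_relations_at 1 t y (conjugate (inv y) x) z"
    and "triple_relations_at 1 t (conjugate x y) x z"
    and "triple_relations_at 1 t x z (conjugate (inv z) y)"
    and "triple_relations_at 1 t x (conjugate y z) y"
proof -
  define d where "d = x \<otimes> y \<otimes> z"
  have [simp]: "d \<in> carrier G"
    by (simp add: d_def)
  define E where "E u \<longleftrightarrow> u \<in> carrier G \<and> (\<forall>k::int. single_lace_rel u (conjugate (d [^] k) t))" for u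
  have gens: "E x" "E y" "E z" "E (conjugate x y)" "E (conjugate (inv z) y)"
    using assms by (simp_all add: triple_relations_at_def E_def d_def)
  have pair: "E (conjugate u v) \<longleftrightarrow> E (conjugate (inv v) u)" if "E u" "E v" for u v
    using that single_lace_conjugate_iff by (simp add: E_def)
  have shift: "E (conjugate d u) \<longleftrightarrow> E u" if "u \<in> carrier G" for u
    using that by (simp add: E_def single_lace_conjugate_powers)
  have yx: "E (conjugate (inv y) x)"
    using gens pair by blast
  have zyx: "E (conjugate (inv z) (conjugate (inv y) x))"
  proof -
    \<comment> \<open>From \<open>d = x y z\<close> follows \<open>d z^-1 y^-1 = x\<close>, and
      conjugation by \<open>x\<close> fixes \<open>x\<close>.\<close>
    have "conjugate d (conjugate (inv z) (conjugate (inv y) x)) = x"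
      by (simp add: d_def conjugate_def word_simps)
    then show ?thesis
      using gens shift[of "conjugate (inv z) (conjugate (inv y) x)"] by simp
  qed
  have xyx: "E (conjugate (conjugate x y) x)"
    using pair[of "conjugate x y" x] gens by simp
  have zx: "E (conjugate (inv z) x)"
  proof -
    \<comment> \<open>Here \<open>d z^-1 = x y\<close>, and \<open>x y\<close> and
      \<open>x y x^-1\<close> conjugate \<open>x\<close> to the same element.\<close>
    have "conjugate d (conjugate (inv z) x) = conjugate (conjugate x y) x"
      by (simp add: d_def conjugate_def word_simps)
    then show ?thesis
      using xyx shift[of "conjugate (inv z) x"] by simp
  qed
  have xz: "E (conjugate x z)"
    using zx gens pair by blast
  have zyz: "E (conjugate (inv (conjugate (inv z) y)) z)"
    using pair[of z "conjugate (inv z) y"] gens by simp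
  have yz: "E (conjugate y z)"
    using gens pair by blast
  have xyz: "E (conjugate x (conjugate y z))"
  proof -
    have "conjugate x (conjugate y z) = conjugate d z"
      by (simp add: d_def conjugate_def word_simps)
    then show ?thesis
      using gens shift[of z] by simp
  qed
  show "triple_relations_at 1 t y (conjugate (inv y) x) z"
    "triple_relations_at 1 t (conjugate x y) x z"
    "triple_relations_at 1 t x z (conjugate (inv z) y)"
    "triple_relations_at 1 t x (conjugate y z) y"
    using gens yx zyx xyx zx xz zyz yz xyz
    by (simp_all add: triple_relations_at_def hurwitz_product E_def flip: d_def)
qed

lemma triple_relations_at_hurwitz:
  assumes "triple_relations_at L t x y z"
  shows "triple_relations_at L t y (conjugate (inv y) x) z"
    and "triple_relations_at L t (conjugate x y) x z"
    and "triple_relations_at L t x z (conjugate (inv z) y)"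
    and "triple_relations_at L t x (conjugate y z) y"
proof -
  consider "L = 0" | "L = 1" | "L = 2" | "L \<notin> {0, 1, 2}"
    by blast
  then have "triple_relations_at L t y (conjugate (inv y) x) z \<and>
    triple_relations_at L t (conjugate x y) x z \<and>
    triple_relations_at L t x z (conjugate (inv z) y) \<and>
    triple_relations_at L t x (conjugate y z) y"
  proof cases
    case 1
    then show ?thesis
      using assms triple_relations_at_0_hurwitz by blast
  next
    case 2
    then show ?thesis
      using assms triple_relations_at_1_hurwitz by blast
  next
    case 3
    then show ?thesis
      using assms triple_relations_at_2_hurwitz by blast
  next
    \<comment> \<open>No clause of \<open>triple_relations_at\<close> is active, so the relations
      hold vacuously.\<close>
    case 4
    then show ?thesis
      by (simp add: triple_relations_at_def)
  qed
  then show "triple_relations_at L t y (conjugate (inv y) x) z"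
    "triple_relations_at L t (conjugate x y) x z"
    "triple_relations_at L t x z (conjugate (inv z) y)"
    "triple_relations_at L t x (conjugate y z) y"
    by blast+
qed

end

end

section \<open>Universal property of presented groups\<close>

definition eval_word :: "('a, 'b) monoid_scheme \<Rightarrow> ('g \<Rightarrow> 'a) \<Rightarrow> 'g word \<Rightarrow> 'a" where
  "eval_word G f w =
    foldr (\<lambda>(g, e) x. (if e then f g else inv\<^bsub>G\<^esub> f g) \<otimes>\<^bsub>G\<^esub> x) w \<one>\<^bsub>G\<^esub>"

lemma words_Cons [simp]: "x # w \<in> words S \<longleftrightarrow> fst x \<in> S \<and> w \<in> words S"
  by (cases x) (auto simp: words_def)

lemma wgen_words [simp]: "wgen g \<in> words S \<longleftrightarrow> g \<in> S"
  by (simp add: wgen_def)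

lemma winv_words_iff [simp]: "winv w \<in> words S \<longleftrightarrow> w \<in> words S"
proof -
  have "winv (winv w) = w"
    by (simp add: winv_def rev_map comp_def split_beta)
  then show ?thesis
    using winv_words by metis
qed

lemma wpow_words: "w \<in> words S \<Longrightarrow> wpow w k \<in> words S"
proof -
  have "concat (replicate m v) \<in> words S" if "v \<in> words S" for m and v :: "'a word"
    using that by (induction m) simp_all
  then show "w \<in> words S \<Longrightarrow> wpow w k \<in> words S"
    by (simp add: wpow_def)
qed

lemma eval_word_Nil [simp]: "eval_word G f [] = \<one>\<^bsub>G\<^esub>"
  by (simp add: eval_word_def)

lemma eval_word_Cons:
  "eval_word G f ((g, e) # w) = (if e then f g else inv\<^bsub>G\<^esub> f g) \<otimes>\<^bsub>G\<^esub> eval_word G f w"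
  by (simp add: eval_word_def)

lemma eval_word_cong:
  "w \<in> words S \<Longrightarrow> (\<And>g. g \<in> S \<Longrightarrow> f g = f' g) \<Longrightarrow> eval_word G f w = eval_word G f' w"
  by (induction w) (auto simp: eval_word_Cons)

context group
begin

context
  fixes f :: "'g \<Rightarrow> 'a" and S
  assumes f: "f \<in> S \<rightarrow> carrier G"
begin

lemma eval_word_closed [simp]: "w \<in> words S \<Longrightarrow> eval_word G f w \<in> carrier G"
  using f by (induction w) (auto simp: eval_word_Cons Pi_iff)

lemma eval_word_wgen: "g \<in> S \<Longrightarrow> eval_word G f (wgen g) = f g"
  using f by (auto simp: wgen_def eval_word_Cons Pi_iff)

lemma eval_word_append:
  "v \<in> words S \<Longrightarrow> w \<in> words S \<Longrightarrow> eval_word G f (v @ w) = eval_word G f v \<otimes> eval_word G f w"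
  using f by (induction v) (auto simp: eval_word_Cons m_assoc Pi_iff)

lemma eval_word_winv:
  "w \<in> words S \<Longrightarrow> eval_word G f (winv w) = inv (eval_word G f w)"
proof (induction w)
  case Nil
  then show ?case
    by (simp add: winv_def)
next
  case (Cons x w)
  obtain g e where x: "x = (g, e)"
    by fastforce
  have [simp]: "g \<in> S" "f g \<in> carrier G" "w \<in> words S"
    using Cons.prems f x by auto
  have "winv (x # w) = winv w @ [(g, \<not> e)]"
    by (simp add: winv_def x)
  then show ?case
    using Cons.IH by (simp add: x eval_word_append) (simp add: eval_word_Cons inv_mult_group)
qed

lemma eval_word_wpow:
  assumes w: "w \<in> words S"
  shows "eval_word G f (wpow w k) = eval_word G f w [^] k"
proof -
  have "eval_word G f (concat (replicate m v)) = eval_word G f v [^] m"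
    if [simp]: "v \<in> words S" for m :: nat and v
  proof (induction m)
    case (Suc m)
    have "concat (replicate m v) \<in> words S"
      using wpow_words[OF that, of "int m"] by (simp add: wpow_def)
    with Suc show ?case
      using nat_pow_Suc2[of "eval_word G f v" m] by (simp add: eval_word_append)
  qed simp
  with w show ?thesis
    by (simp add: wpow_def int_pow_def2 eval_word_winv nat_pow_inv del: pow_nat)
qed

lemmas eval_word_simps =
  eval_word_append eval_word_wgen eval_word_winv eval_word_wpow

text \<open>Only relations with both sides over \<open>S\<close> enter \<open>word_cong\<close>, so
  equality of values is required for those alone.\<close>

lemma eval_word_respects:
  assumes "(v, w) \<in> word_cong S R"
    and R: "\<And>l r. (l, r) \<in> R \<Longrightarrow> l \<in> words S \<Longrightarrow> r \<in> words S
      \<Longrightarrow> eval_word G f l = eval_word G f r"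
  shows "eval_word G f v = eval_word G f w"
  using assms(1)
proof (induction rule: word_cong.induct)
  case (cancel u v g e)
  have "f g \<in> carrier G"
    using cancel f by auto
  with cancel show ?case
    by (simp add: eval_word_append) (simp add: eval_word_Cons inv_cancel_left)
next
  case (rel u v l r)
  then show ?case
    using R by (simp add: eval_word_append)
qed simp_all

end

end

lemma (in group_hom) hom_eval_word:
  assumes f: "f \<in> S \<rightarrow> carrier G" and "w \<in> words S"
  shows "h (eval_word G f w) = eval_word H (h \<circ> f) w"
  using assms(2)
proof (induction w)
  case (Cons x w)
  then show ?case
    using f by (cases x) (auto simp: eval_word_Cons Pi_iff)
qed simp

text \<open>The chosen representative is immaterial once \<open>f\<close> respects the relations.
  Restriction to the carrier makes the map extensional, as membership in \<open>auto\<close>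
  demands.\<close>

definition presented_lift ::
  "'g set \<Rightarrow> ('g word \<times> 'g word) set \<Rightarrow> ('a, 'b) monoid_scheme \<Rightarrow> ('g \<Rightarrow> 'a)
    \<Rightarrow> 'g word set \<Rightarrow> 'a" where
  "presented_lift S R H f =
    (\<lambda>X\<in>carrier (presented_group S R). eval_word H f (SOME w. w \<in> X))"

lemma word_class_in_carrier [simp]:
  "w \<in> words S \<Longrightarrow> word_class S R w \<in> carrier (presented_group S R)"
  by (simp add: carrier_presented_group)

text \<open>Every class is thereby a product of generators and their inverses; with
  \<open>hom_eval_word\<close>, a homomorphism is determined by its values on the
  generators.\<close>

lemma eval_word_presented_group:
  assumes "w \<in> words S"
  shows "eval_word (presented_group S R) (\<lambda>g. word_class S R (wgen g)) w = word_class S R w"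
  using assms
proof (induction w)
  case Nil
  then show ?case
    by (simp add: one_presented_group)
next
  case (Cons x w)
  interpret group "presented_group S R"
    by (rule group_presented_group)
  obtain g e where x: "x = (g, e)"
    by fastforce
  have [simp]: "g \<in> S" "w \<in> words S"
    using Cons.prems x by auto
  have "inv\<^bsub>presented_group S R\<^esub> word_class S R (wgen g) = word_class S R [(g, False)]"
  proof (rule inv_equality)
    have "(winv (wgen g) @ wgen g, []) \<in> word_cong S R"
      by (rule word_cong_winv) simp
    then have "([(g, False)] @ wgen g, []) \<in> word_cong S R"
      by (simp add: winv_def wgen_def)
    then show "word_class S R [(g, False)] \<otimes>\<^bsub>presented_group S R\<^esub> word_class S R (wgen g)
        = \<one>\<^bsub>presented_group S R\<^esub>"
      by (simp add: mult_presented_group one_presented_group word_class_eq_iff)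
  qed simp_all
  then have "(if e then word_class S R (wgen g)
      else inv\<^bsub>presented_group S R\<^esub> word_class S R (wgen g)) = word_class S R [(g, e)]"
    by (simp add: wgen_def)
  then show ?case
    using Cons.IH by (simp add: x eval_word_Cons mult_presented_group del: if_split_eq1)
qed

section \<open>Homomorphisms out of a presented group\<close>

context
  fixes S :: "'g set" and R and H :: "('a, 'b) monoid_scheme" and f
  assumes H: "group H" and f: "f \<in> S \<rightarrow> carrier H"
    and R: "\<And>l r. (l, r) \<in> R \<Longrightarrow> l \<in> words S \<Longrightarrow> r \<in> words S
      \<Longrightarrow> eval_word H f l = eval_word H f r"
begin

lemma presented_lift_word_class:
  assumes w: "w \<in> words S"
  shows "presented_lift S R H f (word_class S R w) = eval_word H f w"
proof -
  have "w \<in> word_class S R w"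
    using w by (auto simp: word_class_def intro: word_cong.refl)
  then have "(SOME v. v \<in> word_class S R w) \<in> word_class S R w"
    by (rule someI)
  then have "(w, SOME v. v \<in> word_class S R w) \<in> word_cong S R"
    by (simp add: word_class_def)
  then show ?thesis
    using group.eval_word_respects[OF H f _ R] w by (simp add: presented_lift_def)
qed

lemma presented_lift_gen:
  "g \<in> S \<Longrightarrow> presented_lift S R H f (word_class S R (wgen g)) = f g"
  by (simp add: presented_lift_word_class group.eval_word_wgen[OF H f])

lemma presented_lift_hom: "presented_lift S R H f \<in> hom (presented_group S R) H"
  by (rule homI)
    (auto simp: carrier_presented_group presented_lift_word_class mult_presented_group
      group.eval_word_closed[OF H f] group.eval_word_append[OF H f])

end

lemma presented_hom_eqI:
  assumes H: "group H"
    and \<phi>: "\<phi> \<in> hom (presented_group S R) H" and \<psi>: "\<psi> \<in> hom (presented_group S R) H"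
    and gens: "\<And>g. g \<in> S \<Longrightarrow> \<phi> (word_class S R (wgen g)) = \<psi> (word_class S R (wgen g))"
    and X: "X \<in> carrier (presented_group S R)"
  shows "\<phi> X = \<psi> X"
proof -
  let ?e = "\<lambda>g. word_class S R (wgen g)"
  obtain w where w: "w \<in> words S" and Xw: "X = word_class S R w"
    using X by (auto simp: carrier_presented_group)
  have e: "?e \<in> S \<rightarrow> carrier (presented_group S R)"
    by simp
  have "\<chi> X = eval_word H (\<chi> \<circ> ?e) w" if "\<chi> \<in> hom (presented_group S R) H" for \<chi>
  proof -
    have "group_hom (presented_group S R) H \<chi>"
      using that H by (simp add: group_hom_def group_hom_axioms_def group_presented_group)
    from group_hom.hom_eval_word[OF this e w] show ?thesis
      by (simp add: Xw eval_word_presented_group w)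
  qed
  from this[OF \<phi>] this[OF \<psi>] show ?thesis
    by (simp, intro eval_word_cong[OF w]) (simp add: gens)
qed

lemma eval_word_presented_relation:
  assumes "(l, r) \<in> R" "l \<in> words S" "r \<in> words S"
  shows "eval_word (presented_group S R) (\<lambda>g. word_class S R (wgen g)) l
    = eval_word (presented_group S R) (\<lambda>g. word_class S R (wgen g)) r"
  using word_cong.rel[of "[]" S "[]" l r R] assms
  by (simp add: eval_word_presented_group word_class_eq_iff)

section \<open>Laces at the affine node\<close>

text \<open>The entry \<open>-3\<close> occurs only in \<open>G2_1\<close> and \<open>D4_3\<close>,
  on the edge between the nodes 1 and 2.\<close>

lemma kac_edges_affine_node:
  assumes "(i, j, p, q) \<in> set (kac_edges X)" "i = 0 \<or> j = 0"
  shows "p \<in> {-1, -2, -4} \<and> q \<in> {-1, -2, -4}"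
  using assms by (cases X) (auto simp: chain_def lace_def split: if_splits)

lemma kac_matrix_affine_node:
  assumes "i = 0 \<or> j = 0"
  shows "kac_matrix X i j \<in> {2, 0, -1, -2, -4}"
proof -
  let ?m = "map_of (concat (map (\<lambda>(i, j, p, q). [((i, j), p), ((j, i), q)]) (kac_edges X))) (i, j)"
  have "a \<in> {-1, -2, -4}" if "?m = Some a" for a
    using map_of_SomeD[OF that] kac_edges_affine_node assms by fastforce
  then show ?thesis
    by (cases ?m) (auto simp: kac_matrix_def)
qed

text \<open>A product equal to 3 would require an entry of absolute value 3. Hence the braid
  relation with six factors never involves the affine node.\<close>

lemma laces_affine_node:
  assumes "labelled_as_in_Kac n A" "i \<le> n"
  shows "laces A 0 i \<noteq> 3"
proof -
  obtain X where "of_kac_type n A X"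
    using assms by (auto simp: labelled_as_in_Kac_def)
  then have "A 0 i = kac_matrix X 0 i" "A i 0 = kac_matrix X i 0"
    using assms(2) by (auto simp: of_kac_type_def)
  then show ?thesis
    using kac_matrix_affine_node[of 0 i X] kac_matrix_affine_node[of i 0 X]
    by (auto simp: laces_def)
qed

section \<open>Homomorphisms from the triple group\<close>

lemma T_in_triple_gens [simp]: "T i \<in> triple_gens n \<longleftrightarrow> i \<in> {1..n}"
  and T0_in_triple_gens [simp]: "T01 \<in> triple_gens n" "T02 \<in> triple_gens n" "T03 \<in> triple_gens n"
  by (auto simp: triple_gens_def)

lemma triple_gens_cases:
  assumes "g \<in> triple_gens n"
  obtains i where "g = T i" "i \<in> {1..n}" | "g \<in> {T01, T02, T03}"
  using assms by (auto simp: triple_gens_def)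

context group
begin

text \<open>These are the families of images from which homomorphisms of the triple group are built.
  Relations away from node 0 stay equations between evaluated words, since no move affects them;
  those at node 0 take the form in which the moves were studied.\<close>

definition triple_family :: "nat \<Rightarrow> (nat \<Rightarrow> nat \<Rightarrow> int) \<Rightarrow> (triple_gen \<Rightarrow> 'a) \<Rightarrow> bool" where
  "triple_family n A f \<longleftrightarrow>
    f \<in> triple_gens n \<rightarrow> carrier G \<and>
    (\<forall>i\<in>{1..n}. \<forall>j\<in>{1..n}. \<forall>m. i \<noteq> j \<longrightarrow>
      (laces A i j, m) \<in> {(0, 2), (1, 3), (2, 4), (3, 6)} \<longrightarrow>
      eval_word G f (alternating m (wgen (T i)) (wgen (T j)))
        = eval_word G f (alternating m (wgen (T j)) (wgen (T i)))) \<and>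
    (\<forall>\<alpha>\<in>{1..n}. triple_relations_at (laces A 0 \<alpha>) (f (T \<alpha>)) (f T01) (f T02) (f T03))"

context
  fixes n :: nat and A :: "nat \<Rightarrow> nat \<Rightarrow> int" and f :: "triple_gen \<Rightarrow> 'a"
  assumes f: "f \<in> triple_gens n \<rightarrow> carrier G"
begin

lemma triple_family_closed [simp]: "g \<in> triple_gens n \<Longrightarrow> f g \<in> carrier G"
  using f by auto

lemma eval_braid_relation:
  assumes "x \<in> words (triple_gens n)" "y \<in> words (triple_gens n)"
  shows "eval_word G f (alternating 2 x y) = eval_word G f (alternating 2 y x)
      \<longleftrightarrow> commuting (eval_word G f x) (eval_word G f y)"
    and "eval_word G f (alternating 3 x y) = eval_word G f (alternating 3 y x)
      \<longleftrightarrow> single_lace_rel (eval_word G f x) (eval_word G f y)"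
    and "eval_word G f (alternating 4 x y) = eval_word G f (alternating 4 y x)
      \<longleftrightarrow> double_lace_rel (eval_word G f x) (eval_word G f y)"
  using assms eval_word_closed[OF f]
  by (simp_all add: numeral_eq_Suc eval_word_append[OF f] commuting_def single_lace_rel_def
    double_lace_rel_def m_assoc)

lemma eval_triple_words:
  assumes "\<alpha> \<in> {1..n}"
  shows "eval_word G f (wpow D_word k @ wgen (T \<alpha>) @ wpow D_word (- k))
      = conjugate ((f T01 \<otimes> f T02 \<otimes> f T03) [^] k) (f (T \<alpha>))"
    and "eval_word G f (wgen T01 @ wgen T02 @ winv (wgen T01)) = conjugate (f T01) (f T02)"
    and "eval_word G f (winv (wgen T03) @ wgen T02 @ wgen T03) = conjugate (inv (f T03)) (f T02)"
proof -
  have D: "D_word \<in> words (triple_gens n)"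
    by (simp add: D_word_def)
  have "eval_word G f D_word = f T01 \<otimes> f T02 \<otimes> f T03"
    by (simp add: D_word_def eval_word_simps[OF f] m_assoc)
  then show "eval_word G f (wpow D_word k @ wgen (T \<alpha>) @ wpow D_word (- k))
      = conjugate ((f T01 \<otimes> f T02 \<otimes> f T03) [^] k) (f (T \<alpha>))"
    using assms D
    by (simp add: eval_word_simps[OF f] wpow_words conjugate_def int_pow_neg m_assoc)
qed (simp_all add: eval_word_simps[OF f] conjugate_def m_assoc)

lemma triple_family_satisfies:
  assumes fam: "triple_family n A f" and laces: "\<And>\<alpha>. \<alpha> \<in> {1..n} \<Longrightarrow> laces A 0 \<alpha> \<noteq> 3"
    and lr: "(l, r) \<in> triple_rels n A"
  shows "eval_word G f l = eval_word G f r"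
proof -
  have at: "triple_relations_at (laces A 0 \<alpha>) (f (T \<alpha>)) (f T01) (f T02) (f T03)"
    if "\<alpha> \<in> {1..n}" for \<alpha>
    using fam that by (simp add: triple_family_def)
  \<comment> \<open>Relation a) between a generator at node 0 and \<open>T \<alpha>\<close>; for one
    lace it is the instance \<open>k = 0\<close> of relation b).\<close>
  have mixed: "eval_word G f (alternating m (wgen g) (wgen (T \<alpha>)))
      = eval_word G f (alternating m (wgen (T \<alpha>)) (wgen g))"
    if \<alpha>: "\<alpha> \<in> {1..n}" and g: "g \<in> {T01, T02, T03}"
      and m: "(laces A 0 \<alpha>, m) \<in> {(0, 2), (1, 3), (2, 4), (3, 6)}" for g \<alpha> m
  proof -
    have gen: "g \<in> triple_gens n"
      using g by auto
    consider "laces A 0 \<alpha> = 0" "m = 2" | "laces A 0 \<alpha> = 1" "m = 3" | "laces A 0 \<alpha> = 2" "m = 4"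
      using m laces[OF \<alpha>] by auto
    then show ?thesis
    proof cases
      case 1
      with at[OF \<alpha>] g gen \<alpha> show ?thesis
        by (auto simp: triple_relations_at_def eval_braid_relation eval_word_wgen[OF f])
    next
      case 2
      then have "single_lace_rel (f g) (conjugate ((f T01 \<otimes> f T02 \<otimes> f T03) [^] (0::int)) (f (T \<alpha>)))"
        using at[OF \<alpha>] g unfolding triple_relations_at_def by blast
      then have "single_lace_rel (f g) (f (T \<alpha>))"
        using \<alpha> by (simp add: conjugate_def)
      with 2 gen \<alpha> show ?thesis
        by (simp add: eval_braid_relation eval_word_wgen[OF f])
    next
      case 3
      with at[OF \<alpha>] g gen \<alpha> show ?thesis
        by (auto simp: triple_relations_at_def eval_braid_relation eval_word_wgen[OF f])
    qed
  qed
  from lr consider "(l, r) \<in> triple_rels_a n A" | "(l, r) \<in> triple_rels_b n A"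
    | "(l, r) \<in> triple_rels_c n A"
    by (auto simp: triple_rels_def)
  then show ?thesis
  proof cases
    case 1
    then obtain g h m where l: "l = alternating m (wgen g) (wgen h)"
      and r: "r = alternating m (wgen h) (wgen g)"
      and g: "g \<in> triple_gens n" and h: "h \<in> triple_gens n" and gh: "node g \<noteq> node h"
      and m: "(laces A (node g) (node h), m) \<in> {(0, 2), (1, 3), (2, 4), (3, 6)}"
      by (auto simp: triple_rels_a_def braid_relation_def)
    show ?thesis
      using g
    proof (cases rule: triple_gens_cases)
      case i: (1 i)
      show ?thesis
        using h
      proof (cases rule: triple_gens_cases)
        case j: (1 j)
        have "i \<noteq> j" "(laces A i j, m) \<in> {(0, 2), (1, 3), (2, 4), (3, 6)}"
          using gh m i j by simp_all
        then show ?thesis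
          unfolding l r i(1) j(1) using fam i(2) j(2) unfolding triple_family_def by blast
      next
        case j: 2
        \<comment> \<open>The number of laces is symmetric, so \<open>mixed\<close> serves both
          orders of the nodes.\<close>
        have "laces A 0 i = laces A (node g) (node h)"
          using i j by (auto simp: laces_def)
        then show ?thesis
          using mixed[of i h m] i j m by (simp add: l r)
      qed
    next
      case i: 2
      show ?thesis
        using h
      proof (cases rule: triple_gens_cases)
        case j: (1 j)
        have "laces A 0 j = laces A (node g) (node h)"
          using i j by auto
        then show ?thesis
          using mixed[of j g m] i j m by (simp add: l r)
      next
        case j: 2
        then show ?thesis
          using i gh by auto
      qed
    qed
  next
    case 2
    then obtain x \<alpha> k where l: "l = alternating 3 x (wpow D_word k @ wgen (T \<alpha>) @ wpow D_word (- k))"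
      and r: "r = alternating 3 (wpow D_word k @ wgen (T \<alpha>) @ wpow D_word (- k)) x"
      and \<alpha>: "\<alpha> \<in> {1..n}" "laces A 0 \<alpha> = 1"
      and x: "x \<in> {wgen T01, wgen T02, wgen T03, wgen T01 @ wgen T02 @ winv (wgen T01),
            winv (wgen T03) @ wgen T02 @ wgen T03}"
      by (auto simp: triple_rels_b_def braid_relation_def)
    have xw: "x \<in> words (triple_gens n)"
      using x by auto
    have "D_word \<in> words (triple_gens n)"
      by (simp add: D_word_def)
    then have w: "wpow D_word k @ wgen (T \<alpha>) @ wpow D_word (- k) \<in> words (triple_gens n)"
      using \<alpha> by (simp add: wpow_words)
    have "eval_word G f x \<in> {f T01, f T02, f T03, conjugate (f T01) (f T02),
        conjugate (inv (f T03)) (f T02)}"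
      using x by (auto simp: eval_triple_words[OF \<alpha>(1)] eval_word_wgen[OF f])
    then have "single_lace_rel (eval_word G f x)
        (conjugate ((f T01 \<otimes> f T02 \<otimes> f T03) [^] k) (f (T \<alpha>)))"
      using at[OF \<alpha>(1)] \<alpha>(2) unfolding triple_relations_at_def by blast
    then show ?thesis
      unfolding l r eval_braid_relation(2)[OF xw w] eval_triple_words(1)[OF \<alpha>(1)] .
  next
    case 3
    then obtain g h \<alpha> where
      l: "l = wgen g @ winv (wgen (T \<alpha>)) @ wgen h @ wgen (T \<alpha>)" and
      r: "r = winv (wgen (T \<alpha>)) @ wgen h @ wgen (T \<alpha>) @ wgen g" and
      \<alpha>: "\<alpha> \<in> {1..n}" "laces A 0 \<alpha> = 2" and gh: "(g, h) \<in> {(T01, T02), (T01, T03), (T02, T03)}"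
      by (auto simp: triple_rels_c_def)
    have [simp]: "g \<in> triple_gens n" "h \<in> triple_gens n"
      using gh by auto
    have "commuting (f g) (conjugate (inv (f (T \<alpha>))) (f h))"
      using at[OF \<alpha>(1)] \<alpha>(2) gh by (auto simp: triple_relations_at_def)
    then show ?thesis
      using \<alpha> by (simp add: l r eval_word_simps[OF f] commuting_def conjugate_def m_assoc)
  qed
qed

text \<open>Converse of \<open>triple_family_satisfies\<close>, applied below to the generators of
  the triple group itself.\<close>

lemma triple_familyI:
  assumes rels: "\<And>l r. (l, r) \<in> triple_rels n A \<Longrightarrow> l \<in> words (triple_gens n)
      \<Longrightarrow> r \<in> words (triple_gens n) \<Longrightarrow> eval_word G f l = eval_word G f r"
  shows "triple_family n A f"
proof -
  have alt: "alternating m (wgen g) (wgen h) \<in> words (triple_gens n)"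
    if "g \<in> triple_gens n" "h \<in> triple_gens n" for m g h
    using that by (induction m arbitrary: g h) simp_all
  have braid: "eval_word G f (alternating m (wgen g) (wgen h))
      = eval_word G f (alternating m (wgen h) (wgen g))"
    if "g \<in> triple_gens n" "h \<in> triple_gens n" "node g \<noteq> node h"
      "(laces A (node g) (node h), m) \<in> {(0, 2), (1, 3), (2, 4), (3, 6)}" for g h m
  proof (rule rels)
    show "(alternating m (wgen g) (wgen h), alternating m (wgen h) (wgen g)) \<in> triple_rels n A"
      using that by (auto simp: triple_rels_def triple_rels_a_def braid_relation_def)
  qed (simp_all add: alt that)
  have "triple_relations_at (laces A 0 \<alpha>) (f (T \<alpha>)) (f T01) (f T02) (f T03)"
    if \<alpha>: "\<alpha> \<in> {1..n}" for \<alpha>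
    unfolding triple_relations_at_def
  proof (intro conjI impI)
    assume 1: "laces A 0 \<alpha> = 1"
    show "\<forall>u\<in>{f T01, f T02, f T03, conjugate (f T01) (f T02), conjugate (inv (f T03)) (f T02)}.
      \<forall>k::int. single_lace_rel u (conjugate ((f T01 \<otimes> f T02 \<otimes> f T03) [^] k) (f (T \<alpha>)))"
    proof (intro ballI allI)
      fix u and k :: int
      let ?v = "wpow D_word k @ wgen (T \<alpha>) @ wpow D_word (- k)"
      assume "u \<in> {f T01, f T02, f T03, conjugate (f T01) (f T02), conjugate (inv (f T03)) (f T02)}"
      \<comment> \<open>Each of the five elements is the value of one of the five words in relation
        b).\<close>
      then obtain x where x: "x \<in> {wgen T01, wgen T02, wgen T03,
            wgen T01 @ wgen T02 @ winv (wgen T01), winv (wgen T03) @ wgen T02 @ wgen T03}"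
        and u: "u = eval_word G f x"
        using eval_triple_words(2,3)[OF \<alpha>] eval_word_wgen[OF f]
        by (elim insertE) (auto simp del: insert_iff, (metis T0_in_triple_gens insertCI)+)
      have xw: "x \<in> words (triple_gens n)"
        using x by auto
      have "D_word \<in> words (triple_gens n)"
        by (simp add: D_word_def)
      then have w: "?v \<in> words (triple_gens n)"
        using \<alpha> by (simp add: wpow_words)
      have "eval_word G f (alternating 3 x ?v) = eval_word G f (alternating 3 ?v x)"
      proof (rule rels)
        show "(alternating 3 x ?v, alternating 3 ?v x) \<in> triple_rels n A"
          using x \<alpha> 1 unfolding triple_rels_def triple_rels_b_def braid_relation_def by blast
      qed (use xw w in \<open>simp_all add: numeral_eq_Suc\<close>)
      then show "single_lace_rel u (conjugate ((f T01 \<otimes> f T02 \<otimes> f T03) [^] k) (f (T \<alpha>)))"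
        unfolding eval_braid_relation(2)[OF xw w] eval_triple_words(1)[OF \<alpha>] u .
    qed
  next
    assume 2: "laces A 0 \<alpha> = 2"
    have "commuting (f g) (conjugate (inv (f (T \<alpha>))) (f h))"
      if gh: "(g, h) \<in> {(T01, T02), (T01, T03), (T02, T03)}" for g h
    proof -
      let ?l = "wgen g @ winv (wgen (T \<alpha>)) @ wgen h @ wgen (T \<alpha>)"
      let ?r = "winv (wgen (T \<alpha>)) @ wgen h @ wgen (T \<alpha>) @ wgen g"
      have [simp]: "g \<in> triple_gens n" "h \<in> triple_gens n"
        using gh by auto
      have "(?l, ?r) \<in> triple_rels n A"
        using gh \<alpha> 2 unfolding triple_rels_def triple_rels_c_def by blast
      then have "eval_word G f ?l = eval_word G f ?r"
        using \<alpha> by (intro rels) simp_all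
      then show ?thesis
        using \<alpha> by (simp add: eval_word_simps[OF f] commuting_def conjugate_def m_assoc)
    qed
    then show "commuting (f T01) (conjugate (inv (f (T \<alpha>))) (f T02))"
      "commuting (f T01) (conjugate (inv (f (T \<alpha>))) (f T03))"
      "commuting (f T02) (conjugate (inv (f (T \<alpha>))) (f T03))"
      by simp_all
  qed (use braid[of T01 "T \<alpha>"] braid[of T02 "T \<alpha>"] braid[of T03 "T \<alpha>"] \<alpha> in
    \<open>auto simp: eval_braid_relation eval_word_wgen[OF f]\<close>)
  moreover have "eval_word G f (alternating m (wgen (T i)) (wgen (T j)))
      = eval_word G f (alternating m (wgen (T j)) (wgen (T i)))"
    if "i \<in> {1..n}" "j \<in> {1..n}" "i \<noteq> j"
      "(laces A i j, m) \<in> {(0, 2), (1, 3), (2, 4), (3, 6)}" for i j m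
    using braid[of "T i" "T j" m] that by (simp only: node.simps T_in_triple_gens simp_thms)
  ultimately show ?thesis
    using f unfolding triple_family_def by blast
qed

end

end

section \<open>Families changed by a Hurwitz move\<close>

context group
begin

context
  fixes n A f
  assumes fam: "triple_family n A f"
begin

text \<open>Words in the \<open>T i\<close> do not see the triple. The hypothesis
  \<open>rels\<close> covers every \<open>L\<close> and \<open>t\<close> because one move must work
  at all nodes simultaneously.\<close>

lemma triple_family_update:
  assumes [simp]: "x \<in> carrier G" "y \<in> carrier G" "z \<in> carrier G"
    and rels: "\<And>L t. triple_relations_at L t (f T01) (f T02) (f T03) \<Longrightarrow> t \<in> carrier G
      \<Longrightarrow> triple_relations_at L t x y z"
  shows "triple_family n A (f(T01 := x, T02 := y, T03 := z))"
proof -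
  let ?f = "f(T01 := x, T02 := y, T03 := z)"
  \<comment> \<open>Over the letters in \<open>range T\<close> the old and the new assignment agree,
    for arbitrary indices.\<close>
  have alt: "alternating m (wgen (T i)) (wgen (T j)) \<in> words (range T)" for m i j
    by (induction m arbitrary: i j) simp_all
  have eval: "eval_word G ?f (alternating m (wgen (T i)) (wgen (T j)))
      = eval_word G f (alternating m (wgen (T i)) (wgen (T j)))" for m i j
    by (rule eval_word_cong[OF alt]) auto
  have f: "f \<in> triple_gens n \<rightarrow> carrier G"
    using fam by (simp add: triple_family_def)
  then have "f (T \<alpha>) \<in> carrier G" if "\<alpha> \<in> {1..n}" for \<alpha>
    using that by auto
  then have "\<forall>\<alpha>\<in>{1..n}. triple_relations_at (laces A 0 \<alpha>) (?f (T \<alpha>)) (?f T01) (?f T02) (?f T03)"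
    using fam rels by (simp add: triple_family_def)
  moreover have "?f \<in> triple_gens n \<rightarrow> carrier G"
    using f by auto
  ultimately show ?thesis
    using fam unfolding triple_family_def eval by blast
qed

text \<open>In order: the move of \<open>assign_a\<close>, its inverse, the move of
  \<open>assign_b\<close>, its inverse. Trivial updates keep the shape of
  \<open>triple_family_update\<close>.\<close>

lemma triple_family_hurwitz:
  shows "triple_family n A
      (f(T01 := f T02, T02 := conjugate (inv (f T02)) (f T01), T03 := f T03))"
    and "triple_family n A
      (f(T01 := conjugate (f T01) (f T02), T02 := f T01, T03 := f T03))"
    and "triple_family n A
      (f(T01 := f T01, T02 := f T03, T03 := conjugate (inv (f T03)) (f T02)))"
    and "triple_family n A
      (f(T01 := f T01, T02 := conjugate (f T02) (f T03), T03 := f T02))"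
proof -
  have [simp]: "f T01 \<in> carrier G" "f T02 \<in> carrier G" "f T03 \<in> carrier G"
    using fam by (auto simp: triple_family_def)
  show "triple_family n A
      (f(T01 := f T02, T02 := conjugate (inv (f T02)) (f T01), T03 := f T03))"
    "triple_family n A
      (f(T01 := conjugate (f T01) (f T02), T02 := f T01, T03 := f T03))"
    "triple_family n A
      (f(T01 := f T01, T02 := f T03, T03 := conjugate (inv (f T03)) (f T02)))"
    "triple_family n A
      (f(T01 := f T01, T02 := conjugate (f T02) (f T03), T03 := f T02))"
    by (rule triple_family_update; simp add: triple_relations_at_hurwitz)+
qed

end

end

section \<open>The action of the braid group\<close>

lemma (in group_hom) hom_conjugate:
  "x \<in> carrier G \<Longrightarrow> y \<in> carrier G \<Longrightarrow> h (G.conjugate x y) = H.conjugate (h x) (h y)"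
  by (simp add: G.conjugate_def H.conjugate_def)

lemma mult_AutoGroup:
  "\<phi> \<in> auto G \<Longrightarrow> \<psi> \<in> auto G \<Longrightarrow> \<phi> \<otimes>\<^bsub>AutoGroup G\<^esub> \<psi> = compose (carrier G) \<phi> \<psi>"
  by (simp add: AutoGroup_def BijGroup_def auto_def)

lemma carrier_AutoGroup [simp]: "carrier (AutoGroup G) = auto G"
  by (simp add: AutoGroup_def)

text \<open>The universal property of the presentation. Extensionality fixes the values outside the
  carrier, so that uniqueness holds for functions.\<close>

lemma braid3_ex1_hom:
  assumes H: "group H" and a: "a \<in> carrier H" and b: "b \<in> carrier H"
    and ab: "a \<otimes>\<^bsub>H\<^esub> (b \<otimes>\<^bsub>H\<^esub> a) = b \<otimes>\<^bsub>H\<^esub> (a \<otimes>\<^bsub>H\<^esub> b)"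
  shows "\<exists>!\<Upsilon>. \<Upsilon> \<in> hom braid3 H \<inter> extensional (carrier braid3) \<and>
    \<Upsilon> (braid3_gen BrA) = a \<and> \<Upsilon> (braid3_gen BrB) = b"
proof (rule ex1I)
  interpret H: group H
    by (rule H)
  let ?f = "case_braid_gen a b"
  have f: "?f \<in> UNIV \<rightarrow> carrier H"
    using a b by (auto split: braid_gen.split)
  have rel: "eval_word H ?f l = eval_word H ?f r" if "(l, r) \<in> braid3_rels" for l r
    using that ab by (auto simp: braid3_rels_def H.eval_word_simps[OF f])
  have "presented_lift UNIV braid3_rels H ?f \<in> extensional (carrier braid3)"
    by (simp add: presented_lift_def braid3_def)
  then show "presented_lift UNIV braid3_rels H ?f \<in> hom braid3 H \<inter> extensional (carrier braid3) \<and>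
      presented_lift UNIV braid3_rels H ?f (braid3_gen BrA) = a \<and>
      presented_lift UNIV braid3_rels H ?f (braid3_gen BrB) = b"
    using presented_lift_hom[OF H f rel] presented_lift_gen[OF H f rel]
    by (simp add: braid3_def braid3_gen_def)
  fix \<Upsilon>
  assume \<Upsilon>: "\<Upsilon> \<in> hom braid3 H \<inter> extensional (carrier braid3) \<and>
    \<Upsilon> (braid3_gen BrA) = a \<and> \<Upsilon> (braid3_gen BrB) = b"
  show "\<Upsilon> = presented_lift UNIV braid3_rels H ?f"
  proof (rule extensionalityI[of _ "carrier braid3"])
    fix X
    assume X: "X \<in> carrier braid3"
    have gen: "\<Upsilon> (word_class UNIV braid3_rels (wgen g))
        = presented_lift UNIV braid3_rels H ?f (word_class UNIV braid3_rels (wgen g))" for g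
      using \<Upsilon> presented_lift_gen[OF H f rel, where g = g] by (cases g) (simp_all add: braid3_gen_def)
    show "\<Upsilon> X = presented_lift UNIV braid3_rels H ?f X"
      by (rule presented_hom_eqI[OF H _ presented_lift_hom[OF H f rel] gen])
        (use \<Upsilon> X in \<open>simp_all add: braid3_def\<close>)
  qed (use \<Upsilon> in \<open>simp_all add: presented_lift_def braid3_def\<close>)
qed

lemma (in group) autoI:
  assumes "\<phi> \<in> hom G G" "\<phi> \<in> extensional (carrier G)" "\<psi> \<in> hom G G"
    and "\<And>x. x \<in> carrier G \<Longrightarrow> \<psi> (\<phi> x) = x" "\<And>x. x \<in> carrier G \<Longrightarrow> \<phi> (\<psi> x) = x"
  shows "\<phi> \<in> auto G"
proof -
  have "bij_betw \<phi> (carrier G) (carrier G)"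
    by (rule bij_betw_byWitness[where f' = \<psi>]) (use assms in \<open>auto dest: hom_in_carrier\<close>)
  then show ?thesis
    using assms by (simp add: auto_def Bij_def)
qed

text \<open>Elements of \<open>auto\<close> are extensional, so agreement on generators forces
  equality as functions.\<close>

lemma triple_group_auto_unique:
  assumes "\<phi> \<in> auto (triple_group n A)" "\<psi> \<in> auto (triple_group n A)"
    and "extends_assignment n A f \<phi>" "extends_assignment n A f \<psi>"
  shows "\<phi> = \<psi>"
proof (rule extensionalityI[of _ "carrier (triple_group n A)"])
  have "group (triple_group n A)"
    by (simp add: triple_group_def group_presented_group)
  then show "\<phi> X = \<psi> X" if "X \<in> carrier (triple_group n A)" for X
    using assms that presented_hom_eqI[where S = "triple_gens n" and R = "triple_rels n A"]
    unfolding triple_group_def extends_assignment_def triple_class_def auto_def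
    by (metis IntD1)
qed (use assms in \<open>auto simp: auto_def Bij_def\<close>)

theorem theorem2p6:
  fixes n :: nat and A :: "nat \<Rightarrow> nat \<Rightarrow> int"
  assumes "irreducible_affine_cartan_matrix n A"
    and "labelled_as_in_Kac n A"
    and "\<nexists>l. of_kac_type n A (B_1 l)"
    and "\<nexists>l. of_kac_type n A (C_1 l)"
    and "\<not> of_kac_type n A F4_1"
    and "\<not> of_kac_type n A G2_1"
  shows "\<exists>\<phi>\<^sub>a \<phi>\<^sub>b.
      \<phi>\<^sub>a \<in> auto (triple_group n A) \<and> extends_assignment n A assign_a \<phi>\<^sub>a \<and>
      (\<forall>\<psi> \<in> auto (triple_group n A). extends_assignment n A assign_a \<psi> \<longrightarrow> \<psi> = \<phi>\<^sub>a) \<and>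
      \<phi>\<^sub>b \<in> auto (triple_group n A) \<and> extends_assignment n A assign_b \<phi>\<^sub>b \<and>
      (\<forall>\<psi> \<in> auto (triple_group n A). extends_assignment n A assign_b \<psi> \<longrightarrow> \<psi> = \<phi>\<^sub>b) \<and>
      (\<exists>!\<Upsilon>. \<Upsilon> \<in> hom braid3 (AutoGroup (triple_group n A)) \<inter> extensional (carrier braid3) \<and>
         \<Upsilon> (braid3_gen BrA) = \<phi>\<^sub>a \<and> \<Upsilon> (braid3_gen BrB) = \<phi>\<^sub>b)"
proof -
  define G where "G = triple_group n A"
  define e where "e g = triple_class n A (wgen g)" for g
  interpret group G
    by (simp add: G_def triple_group_def group_presented_group)
  have G: "group G" ..
  have e_closed [simp]: "e g \<in> carrier G" if "g \<in> triple_gens n" for g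
    using that by (simp add: G_def triple_group_def e_def triple_class_def)
  have e_fun: "e \<in> triple_gens n \<rightarrow> carrier G"
    by simp
  have eval_e: "eval_word G e w = triple_class n A w" if "w \<in> words (triple_gens n)" for w
    using eval_word_presented_group[OF that, of "triple_rels n A"]
    by (simp add: G_def triple_group_def e_def[abs_def] triple_class_def)
  have fam: "triple_family n A e"
    by (rule triple_familyI[OF e_fun])
      (use eval_word_presented_relation[of _ _ "triple_rels n A" "triple_gens n"] in
        \<open>simp add: G_def triple_group_def e_def[abs_def] triple_class_def\<close>)
  define ext where "ext f = presented_lift (triple_gens n) (triple_rels n A) G f"
    for f :: "triple_gen \<Rightarrow> triple_gen word set"
  have ext: "ext f \<in> hom G G" "ext f \<in> extensional (carrier G)"
    "\<And>g. g \<in> triple_gens n \<Longrightarrow> ext f (e g) = f g" if f: "triple_family n A f" for f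
  proof -
    have cl: "f \<in> triple_gens n \<rightarrow> carrier G"
      using f by (simp add: triple_family_def)
    note rel = triple_family_satisfies[OF cl f laces_affine_node[OF assms(2)]]
    show "ext f \<in> hom G G"
      using presented_lift_hom[OF G cl rel, where R = "triple_rels n A"]
      by (simp add: ext_def) (simp add: G_def triple_group_def)
    show "ext f \<in> extensional (carrier G)"
      by (simp add: ext_def presented_lift_def G_def triple_group_def)
    show "ext f (e g) = f g" if "g \<in> triple_gens n" for g
      using presented_lift_gen[OF G cl rel that, where R = "triple_rels n A"]
      by (simp add: ext_def e_def triple_class_def)
  qed
  have hom_eqI: "\<phi> x = \<psi> x"
    if "\<phi> \<in> hom G G" "\<psi> \<in> hom G G" "\<And>g. g \<in> triple_gens n \<Longrightarrow> \<phi> (e g) = \<psi> (e g)" "x \<in> carrier G"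
    for \<phi> \<psi> x
    using presented_hom_eqI[OF G, of \<phi> "triple_gens n" "triple_rels n A" \<psi> x] that
    by (simp add: G_def triple_group_def e_def triple_class_def)
  \<comment> \<open>\<open>fa\<close> and \<open>fb\<close> are the given assignments,
    \<open>fa'\<close> and \<open>fb'\<close> the inverse moves.\<close>
  define fa where "fa = e(T01 := e T02, T02 := conjugate (inv\<^bsub>G\<^esub> (e T02)) (e T01), T03 := e T03)"
  define fa' where "fa' = e(T01 := conjugate (e T01) (e T02), T02 := e T01, T03 := e T03)"
  define fb where "fb = e(T01 := e T01, T02 := e T03, T03 := conjugate (inv\<^bsub>G\<^esub> (e T03)) (e T02))"
  define fb' where "fb' = e(T01 := e T01, T02 := conjugate (e T02) (e T03), T03 := e T02)"
  note fams = triple_family_hurwitz[OF fam, folded fa_def fa'_def fb_def fb'_def]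
  define a where "a = ext fa"
  define a' where "a' = ext fa'"
  define b where "b = ext fb"
  define b' where "b' = ext fb'"
  note homs = ext(1)[OF fams(1), folded a_def] ext(1)[OF fams(2), folded a'_def]
    ext(1)[OF fams(3), folded b_def] ext(1)[OF fams(4), folded b'_def]
  have hom: "group_hom G G \<phi>" if "\<phi> \<in> hom G G" for \<phi>
    using that G by (simp add: group_hom_def group_hom_axioms_def)
  note hom_conj = group_hom.hom_conjugate[OF hom] and hom_inv = group_hom.hom_inv[OF hom]
  have on_gens: "a (e T01) = e T02" "a (e T02) = conjugate (inv\<^bsub>G\<^esub> (e T02)) (e T01)" "a (e T03) = e T03"
    "a' (e T01) = conjugate (e T01) (e T02)" "a' (e T02) = e T01" "a' (e T03) = e T03"
    "b (e T01) = e T01" "b (e T02) = e T03" "b (e T03) = conjugate (inv\<^bsub>G\<^esub> (e T03)) (e T02)"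
    "b' (e T01) = e T01" "b' (e T02) = conjugate (e T02) (e T03)" "b' (e T03) = e T02"
    "\<And>i. i \<in> {1..n} \<Longrightarrow> a (e (T i)) = e (T i) \<and> a' (e (T i)) = e (T i)"
    "\<And>i. i \<in> {1..n} \<Longrightarrow> b (e (T i)) = e (T i) \<and> b' (e (T i)) = e (T i)"
    unfolding a_def a'_def b_def b'_def
    using ext(3)[OF fams(1)] ext(3)[OF fams(2)] ext(3)[OF fams(3)] ext(3)[OF fams(4)]
    by (simp_all add: fa_def fa'_def fb_def fb'_def)
  have comp: "(\<lambda>x. \<phi> (\<psi> x)) \<in> hom G G" if "\<phi> \<in> hom G G" "\<psi> \<in> hom G G" for \<phi> \<psi>
    using that by (auto simp: hom_def Pi_iff)
  have id: "(\<lambda>x. x) \<in> hom G G"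
    by (simp add: hom_def)
  have inverse: "a' (a x) = x" "a (a' x) = x" "b' (b x) = x" "b (b' x) = x"
    if x: "x \<in> carrier G" for x
  proof -
    \<comment> \<open>For instance, with \<open>x, y\<close> for \<open>e T01, e T02\<close>, the
      map \<open>a\<close> sends \<open>y\<close> to \<open>y^-1 x y\<close>, and \<open>a'\<close>
      sends this to \<open>x^-1 (x y x^-1) x = y\<close>.\<close>
    have "a' (a (e g)) = e g \<and> a (a' (e g)) = e g \<and> b' (b (e g)) = e g \<and> b (b' (e g)) = e g"
      if "g \<in> triple_gens n" for g
      using that by (cases g) (simp_all add: on_gens homs hom_conj hom_inv conjugate_of_conjugate)
    then show "a' (a x) = x" "a (a' x) = x" "b' (b x) = x" "b (b' x) = x"
      using hom_eqI[OF comp[OF homs(2,1)] id _ x] hom_eqI[OF comp[OF homs(1,2)] id _ x]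
        hom_eqI[OF comp[OF homs(4,3)] id _ x] hom_eqI[OF comp[OF homs(3,4)] id _ x] by blast+
  qed
  have autos: "a \<in> auto G" "b \<in> auto G"
    using autoI[of a a'] autoI[of b b'] inverse homs ext(2)[OF fams(1)] ext(2)[OF fams(3)]
    by (simp_all add: a_def b_def)
  have aba: "a (b (a x)) = b (a (b x))" if x: "x \<in> carrier G" for x
  proof (rule hom_eqI[OF comp[OF homs(1) comp[OF homs(3,1)]] comp[OF homs(3) comp[OF homs(1,3)]] _ x])
    fix g
    assume "g \<in> triple_gens n"
    \<comment> \<open>With \<open>x, y, z\<close> for \<open>e T01, e T02, e T03\<close>, both sides
      send the triple to \<open>z\<close>, \<open>z^-1 y z\<close>,
      \<open>(y z)^-1 x (y z)\<close>.\<close>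
    then show "a (b (a (e g))) = b (a (b (e g)))"
      by (cases g) (simp_all add: on_gens homs hom_conj hom_inv conjugate_of_conjugate)
  qed
  have "a \<otimes>\<^bsub>AutoGroup G\<^esub> (b \<otimes>\<^bsub>AutoGroup G\<^esub> a) = b \<otimes>\<^bsub>AutoGroup G\<^esub> (a \<otimes>\<^bsub>AutoGroup G\<^esub> b)"
  proof -
    interpret Aut: group "AutoGroup G"
      by (rule AutoGroup)
    have "b \<otimes>\<^bsub>AutoGroup G\<^esub> a \<in> auto G" "a \<otimes>\<^bsub>AutoGroup G\<^esub> b \<in> auto G"
      using Aut.m_closed autos by simp_all
    \<comment> \<open>Products in \<open>AutoGroup G\<close> are compositions restricted to the
      carrier, so \<open>aba\<close> on the carrier suffices.\<close>
    then have "a \<otimes>\<^bsub>AutoGroup G\<^esub> (b \<otimes>\<^bsub>AutoGroup G\<^esub> a) = compose (carrier G) a (compose (carrier G) b a)"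
      "b \<otimes>\<^bsub>AutoGroup G\<^esub> (a \<otimes>\<^bsub>AutoGroup G\<^esub> b) = compose (carrier G) b (compose (carrier G) a b)"
      using autos by (metis mult_AutoGroup)+
    then show ?thesis
      using aba by (simp add: compose_def cong: restrict_cong)
  qed
  then have braid: "\<exists>!\<Upsilon>. \<Upsilon> \<in> hom braid3 (AutoGroup G) \<inter> extensional (carrier braid3) \<and>
      \<Upsilon> (braid3_gen BrA) = a \<and> \<Upsilon> (braid3_gen BrB) = b"
    using autos by (intro braid3_ex1_hom AutoGroup) simp_all
  have class_gen: "triple_class n A (wgen g) = e g" for g
    by (simp add: e_def)
  have class_conj: "triple_class n A (winv (wgen g) @ wgen h @ wgen g)
      = conjugate (inv\<^bsub>G\<^esub> (e g)) (e h)"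
    if "g \<in> triple_gens n" "h \<in> triple_gens n" for g h
    using that eval_e[of "winv (wgen g) @ wgen h @ wgen g"]
    by (simp add: eval_word_simps[OF e_fun] conjugate_def m_assoc)
  have "extends_assignment n A assign_a a \<and> extends_assignment n A assign_b b"
  proof -
    have "a (e g) = triple_class n A (assign_a g) \<and> b (e g) = triple_class n A (assign_b g)"
      if "g \<in> triple_gens n" for g
      using that by (cases g) (simp_all add: class_gen class_conj on_gens)
    then show ?thesis
      by (simp add: extends_assignment_def class_gen)
  qed
  then show ?thesis
    using autos braid triple_group_auto_unique unfolding G_def by blast
qed

end
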